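(* Let $\mathbb{K}$ be a field, let $e>0$ be an integer, and let $R(t)\in\mathbb{K}\llbracket t\rrbracket$ be a formal power series (not involving the variable $q$) with $R(0)\neq 0$. Let $H_1(q),\dots,H_e(q)$ be the $e$ distinct Newton--Puiseux series solutions $H$ of the equation $$H^e(q)=q\,R\big(H(q)\big).$$ Define $$G_e(R)=\exp\bigg[-\sum_{n,m>0,\ j>0} j\,\frac{1}{m}[z^{me+j}]\big\{R^m(z)\big\}\,\frac{1}{n}[z^{ne-j}]\big\{R^n(z)\big\}\,q^{n+m}\bigg].$$ Then $$G_e(R)=\prod_{i=1}^e\bigg(\frac{R(H_i)}{R(0)}\bigg)\prod_{i=1}^e H_i^{e}\cdot\prod_{i_1\neq i_2}\bigg(\frac{1}{H_{i_2}-H_{i_1}}\bigg)\prod_{i=1}^e\bigg(\frac{e}{H_i}-\frac{R'(H_i)}{R(H_i)}\bigg),$$ where the product over $i_1\neq i_2$ runs over ordered pairs $(i_1,i_2)$ of distinct indices in $\{1,\dots,e\}$.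
   Context: For a (Laurent or power) series $f(z)$, $[z^k]\{f(z)\}$ denotes the coefficient of $z^k$ in $f$ (taken to be $0$ when $k<0$ for a power series). Newton--Puiseux series are formal series in fractional powers of $q$ (here in $q^{1/e}$), and the solutions $H_i$ are those vanishing at $q=0$; the identity is an identity of such formal series. $R'$ denotes the formal derivative of $R$.
   Formalization: The field K is taken to have characteristic 0, since the factors 1/m, 1/n and the exponential defining G_e(R) are undefined in positive characteristic; the solutions H_i have coefficients in the algebraic closure of K. *)

theory Defs
  imports
    "HOL-Computational_Algebra.Formal_Laurent_Series"
    "HOL-Algebra.Algebraic_Closure_Type"
begin

unbundle fps_syntax

text \<open>
  The exponent of \<open>G\<^sub>e(R)\<close> is a power series in \<open>q\<close>. For \<open>j > n e\<close> the coefficient of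
  \<open>z\<close> to the \<open>n e - j\<close> in \<open>R\<close> to the \<open>n\<close> is zero by convention, so only \<open>j \<le> n e\<close> is
  summed: this makes the sum for each power of \<open>q\<close> finite, and the truncated subtraction
  \<open>n * e - j\<close> exact.
\<close>

definition G_exponent :: "nat \<Rightarrow> 'a::field_char_0 fps \<Rightarrow> 'a fps" where
  "G_exponent e R = - Abs_fps (\<lambda>k.
     \<Sum>(n, m, j) \<in> {(n, m, j). n > 0 \<and> m > 0 \<and> j > 0 \<and> n + m = k \<and> j \<le> n * e}.
       of_nat j * (1 / of_nat m * (R ^ m) $ (m * e + j)) * (1 / of_nat n * (R ^ n) $ (n * e - j)))"

definition G :: "nat \<Rightarrow> 'a::field_char_0 fps \<Rightarrow> 'a fps" where
  "G e R = fps_exp 1 oo G_exponent e R"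

definition fps_to_ac :: "'a::field fps \<Rightarrow> 'a alg_closure fps" where
  "fps_to_ac F = Abs_fps (\<lambda>n. to_ac (F $ n))"

text \<open>
  Newton--Puiseux series in \<open>q\<close> to the \<open>1/e\<close> vanishing at \<open>q = 0\<close> are represented as power
  series in a variable \<open>s\<close> with zero constant term, where \<open>q\<close> is \<open>s\<close> to the \<open>e\<close>. Their
  coefficients lie in the algebraic closure of the base field, since in general the base field
  contains neither the \<open>e\<close>-th roots of unity nor an \<open>e\<close>-th root of \<open>R(0)\<close>.
\<close>

definition in_q :: "nat \<Rightarrow> 'a::field fps \<Rightarrow> 'a alg_closure fps" where
  "in_q e F = fps_to_ac F oo fps_X ^ e"

definition puiseux_solutions :: "nat \<Rightarrow> 'a::field fps \<Rightarrow> 'a alg_closure fps set" where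
  "puiseux_solutions e R =
     {H. H $ 0 = 0 \<and> H ^ e = in_q e fps_X * (fps_to_ac R oo H)}"

text \<open>The Laurent series \<open>F(H)\<close>, meaningful for \<open>H\<close> with zero constant term.\<close>

definition subst_fls :: "'a::field fps \<Rightarrow> 'a alg_closure fps \<Rightarrow> 'a alg_closure fls" where
  "subst_fls F H = fps_to_fls (fps_to_ac F oo H)"

end

theory Submission
  imports Defs
begin

text \<open>
  Choose \<open>\<rho>\<close> with \<open>\<rho>\<^sup>e = R\<close> over the algebraic closure and let \<open>H\<close> be the compositional inverse of
  \<open>\<phi> = z / \<rho>(z)\<close>. The solutions are \<open>H(w s)\<close> for the \<open>e\<close>-th roots of unity \<open>w\<close>, so every factor
  of the product formula is a value of the divided difference
  \<open>Q(t, s) = (H(t) - H(s)) / (t - s)\<close> at \<open>(v s, w s)\<close>, \<open>(v s, 0)\<close> or \<open>(0, w s)\<close>, and the right-hand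
  side collapses to the product of \<open>Q(v s, 0) Q(0, w s) / (Q(v s, w s) Q(0, 0))\<close> over all pairs
  \<open>(v, w)\<close>. The logarithm of \<open>Q(t, 0) Q(0, s) / (Q(t, s) Q(0, 0))\<close> is a Grunsky-type series whose
  coefficients are, by Lagrange inversion applied in both variables,
  \<open>- \<Sum>\<^sub>j j (1/a) [z\<^bsup>a+j\<^esup>]\<rho>\<^sup>a (1/b) [z\<^bsup>b-j\<^esup>]\<rho>\<^sup>b\<close>. Summing over roots of unity keeps only those \<open>a\<close>,
  \<open>b\<close> divisible by \<open>e\<close>, which yields the exponent of \<open>G\<close>. Logarithms are avoided by comparing
  logarithmic derivatives with respect to \<open>s\<close>.
\<close>

section \<open>Power series in two variables\<close>

text \<open>
  A series in \<open>t\<close> and \<open>s\<close> is an element of \<open>'b fps fps\<close>: the outer variable is \<open>t\<close>, the inner one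
  \<open>s\<close>. Thus \<open>fps_lift F\<close> is \<open>F(t)\<close>, \<open>fps_const F\<close> is \<open>F(s)\<close>, and \<open>fps_eval2 \<alpha> \<beta> A\<close> is
  \<open>A(\<alpha> s, \<beta> s)\<close>.
\<close>

definition fps_lift :: "'b::zero fps \<Rightarrow> 'b fps fps" where
  "fps_lift F = Abs_fps (\<lambda>n. fps_const (F $ n))"

lemma fps_lift_nth [simp]: "fps_lift F $ n = fps_const (F $ n)"
  by (simp add: fps_lift_def)

lemma fps_lift_1 [simp]: "fps_lift (1 :: 'b::comm_ring_1 fps) = 1"
  by (simp add: fps_eq_iff)

lemma fps_lift_X [simp]: "fps_lift (fps_X :: 'b::comm_ring_1 fps) = fps_X"
  by (rule fps_ext) (simp add: fps_X_def)

lemma fps_const_sum: "fps_const (sum f A) = (\<Sum>x\<in>A. fps_const (f x))"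
  by (induction A rule: infinite_finite_induct) (simp_all flip: fps_const_add)

lemma fps_lift_mult: "fps_lift (F * E) = fps_lift F * fps_lift (E :: 'b::comm_ring_1 fps)"
  by (rule fps_ext) (simp add: fps_mult_nth fps_const_sum flip: fps_const_mult)

lemma fps_lift_power: "fps_lift (F ^ n) = fps_lift (F :: 'b::comm_ring_1 fps) ^ n"
  by (induction n) (simp_all add: fps_lift_mult)

lemma fps_lift_compose: "fps_lift (F oo E) = fps_lift F oo fps_lift (E :: 'b::comm_ring_1 fps)"
  by (rule fps_ext)
    (simp add: fps_compose_nth fps_const_sum flip: fps_const_mult fps_lift_power)

lemma fps_lift_deriv: "fps_lift (fps_deriv F) = fps_deriv (fps_lift (F :: 'b::comm_ring_1 fps))"
  by (rule fps_ext) (simp flip: fps_of_nat fps_const_add fps_const_mult)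

definition fps_eval2 :: "'b::comm_ring_1 \<Rightarrow> 'b \<Rightarrow> 'b fps fps \<Rightarrow> 'b fps" where
  "fps_eval2 \<alpha> \<beta> A = Abs_fps (\<lambda>n. \<Sum>i\<le>n. \<alpha> ^ i * \<beta> ^ (n - i) * A $ i $ (n - i))"

lemma fps_eval2_nth:
  "fps_eval2 \<alpha> \<beta> A $ n = (\<Sum>i\<le>n. \<alpha> ^ i * \<beta> ^ (n - i) * A $ i $ (n - i))"
  by (simp add: fps_eval2_def)

text \<open>Substitution of (\<alpha> s, \<beta> s) respects products: on coefficients, both sides
  enumerate the same pairs of monomials, one from each factor, of total degree
  \<open>n\<close>.\<close>

lemma fps_eval2_mult: "fps_eval2 \<alpha> \<beta> (A * B) = fps_eval2 \<alpha> \<beta> A * fps_eval2 \<alpha> \<beta> B"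
proof (rule fps_ext)
  fix n
  have "fps_eval2 \<alpha> \<beta> (A * B) $ n =
      (\<Sum>i\<le>n. \<Sum>p\<le>i. \<Sum>q\<le>n-i. \<alpha> ^ i * \<beta> ^ (n - i) * (A $ p $ q * B $ (i - p) $ (n - i - q)))"
    by (simp add: fps_eval2_nth fps_mult_nth fps_sum_nth sum_distrib_left atMost_atLeast0)
  also have "\<dots> = (\<Sum>(i, p, q) \<in> (SIGMA i:{..n}. {..i} \<times> {..n-i}).
      \<alpha> ^ i * \<beta> ^ (n - i) * (A $ p $ q * B $ (i - p) $ (n - i - q)))"
    by (simp add: sum.Sigma sum.cartesian_product)
  also have "\<dots> = (\<Sum>(m, p, r) \<in> (SIGMA m:{..n}. {..m} \<times> {..n-m}).
      (\<alpha> ^ p * \<beta> ^ (m - p) * A $ p $ (m - p)) *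
      (\<alpha> ^ r * \<beta> ^ (n - m - r) * B $ r $ (n - m - r)))"
  \<comment> \<open>On the left, \<open>i\<close> is the total exponent of t, while \<open>p\<close>
    and \<open>q\<close> are the exponents of t and s in the monomial of \<open>A\<close>. On the
    right, \<open>m = p + q\<close> is the degree of that monomial and \<open>r = i - p\<close> is
    the exponent of t in the monomial of \<open>B\<close>.\<close>
  proof (rule sum.reindex_bij_witness[of _
        "\<lambda>(m, p, r). (p + r, p, m - p)" "\<lambda>(i, p, q). (p + q, p, i - p)"], goal_cases)
    case (5 x)
    obtain i p q where x: "x = (i, p, q)" by (cases x)
    have le: "i \<le> n" "p \<le> i" "q \<le> n - i" using 5 by (auto simp: x)
    have e: "\<alpha> ^ p * \<alpha> ^ (i - p) = \<alpha> ^ i" "\<beta> ^ q * \<beta> ^ (n - i - q) = \<beta> ^ (n - i)"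
      using le by (simp_all flip: power_add)
    moreover have "n - (p + q) - (i - p) = n - i - q"
      using le by simp
    ultimately show ?case
      using le by (simp add: x mult_ac flip: e)
  qed auto
  also have "\<dots> = (\<Sum>m\<le>n. \<Sum>p\<le>m. \<Sum>r\<le>n-m. (\<alpha> ^ p * \<beta> ^ (m - p) * A $ p $ (m - p)) *
      (\<alpha> ^ r * \<beta> ^ (n - m - r) * B $ r $ (n - m - r)))"
    by (simp add: sum.Sigma sum.cartesian_product)
  also have "\<dots> = (fps_eval2 \<alpha> \<beta> A * fps_eval2 \<alpha> \<beta> B) $ n"
    by (simp add: fps_eval2_nth fps_mult_nth sum_product atMost_atLeast0)
  finally show "fps_eval2 \<alpha> \<beta> (A * B) $ n = \<dots>" .
qed

section \<open>Lagrange inversion\<close>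

text \<open>Differentiating \<phi> \<rho> = X gives k \<phi>' \<rho>^(k+1) = k \<rho>^k - X
  (\<rho>^k)', and X d/dX multiplies coefficient m by m. The vanishing at m = k > 0 expresses that
  the derivative of \<phi>^(-k) has no residue.\<close>

lemma fps_deriv_mult_power_nth:
  fixes \<phi> \<rho> :: "'r::comm_ring_1 fps"
  assumes "\<phi> * \<rho> = fps_X"
  shows "of_nat k * (fps_deriv \<phi> * \<rho> ^ Suc k) $ m = (of_nat k - of_nat m) * \<rho> ^ k $ m"
proof (cases k)
  case (Suc l)
  have "fps_deriv (\<phi> * \<rho>) = 1"
    by (simp add: assms)
  hence *: "fps_deriv \<phi> * \<rho> = 1 - \<phi> * fps_deriv \<rho>"
    by (simp add: algebra_simps)
  have "of_nat k * (fps_deriv \<phi> * \<rho> ^ Suc k) = of_nat k * ((fps_deriv \<phi> * \<rho>) * \<rho> ^ k)"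
    by (simp add: mult_ac)
  also have "\<dots> = of_nat k * \<rho> ^ k - (\<phi> * \<rho>) * (of_nat k * fps_deriv \<rho> * \<rho> ^ l)"
    unfolding * by (simp add: Suc algebra_simps)
  also have "\<dots> = of_nat k * \<rho> ^ k - fps_X * fps_deriv (\<rho> ^ k)"
    by (simp only: assms Suc fps_deriv_power' diff_Suc_1)
  finally have "of_nat k * (fps_deriv \<phi> * \<rho> ^ Suc k) $ m
      = (of_nat k * \<rho> ^ k - fps_X * fps_deriv (\<rho> ^ k)) $ m"
    by (metis fps_of_nat fps_mult_left_const_nth)
  also have "\<dots> = (of_nat k - of_nat m) * \<rho> ^ k $ m"
    by (cases m) (simp_all add: algebra_simps flip: fps_of_nat)
  finally show ?thesis .
qed (auto simp: fps_one_nth)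

text \<open>The right-hand side is the residue of F(\<phi>) \<phi>' / \<phi>^(a+1), with 1 / \<phi>
  written as \<rho> / X so that no Laurent series occur. By linearity it suffices that for F = X^i
  this residue is 1 if i = a and 0 if i < a. The coefficients form a domain rather than a field, so
  that they may themselves be power series in s.\<close>

lemma fps_Lagrange:
  fixes \<phi> \<rho> F :: "'r::{idom, semiring_char_0} fps"
  assumes \<phi>\<rho>: "\<phi> * \<rho> = fps_X" and \<phi>0: "\<phi> $ 0 = 0"
  shows "F $ a = ((F oo \<phi>) * fps_deriv \<phi> * \<rho> ^ Suc a) $ a"
proof -
  have mono: "(\<phi> ^ i * (fps_deriv \<phi> * \<rho> ^ Suc a)) $ a = (if i = a then 1 else 0)" if "i \<le> a" for i
  proof -
    have split: "\<phi> ^ i * (fps_deriv \<phi> * \<rho> ^ Suc a) = (\<phi> * \<rho>) ^ i * (fps_deriv \<phi> * \<rho> ^ Suc (a - i))"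
    proof -
      have "\<rho> ^ Suc a = \<rho> ^ i * \<rho> ^ Suc (a - i)"
        using that by (simp flip: power_add power_Suc)
      thus ?thesis by (simp only: power_mult_distrib mult_ac)
    qed
    have eq: "(\<phi> ^ i * (fps_deriv \<phi> * \<rho> ^ Suc a)) $ a = (fps_deriv \<phi> * \<rho> ^ Suc (a - i)) $ (a - i)"
      unfolding split \<phi>\<rho> using that by (simp add: fps_X_power_mult_nth del: power_Suc)
    show ?thesis
    proof (cases "i = a")
      case True
      have "fps_deriv (\<phi> * \<rho>) $ 0 = 1" by (simp add: \<phi>\<rho>)
      thus ?thesis using True eq by (simp add: \<phi>0)
    next
      case False
      \<comment> \<open>Exponent and index coincide, which makes the right-hand side of
        \<open>fps_deriv_mult_power_nth\<close> zero; the nonzero integer \<open>a - i\<close> then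
        cancels in characteristic 0.\<close>
      have "of_nat (a - i) * (fps_deriv \<phi> * \<rho> ^ Suc (a - i)) $ (a - i) = 0"
        by (subst fps_deriv_mult_power_nth[OF \<phi>\<rho>]) simp
      thus ?thesis using False that by (simp add: eq del: power_Suc)
    qed
  qed
  define w where "w = fps_deriv \<phi> * \<rho> ^ Suc a"
  have "((F oo \<phi>) * w) $ a = (\<Sum>p\<le>a. (\<Sum>i\<le>p. F $ i * \<phi> ^ i $ p) * w $ (a - p))"
    by (simp add: fps_mult_nth fps_compose_nth atMost_atLeast0)
  \<comment> \<open>As \<phi>^i has no terms below degree i, the inner range can be extended to one
    independent of p, which permits exchanging the sums.\<close>
  also have "\<dots> = (\<Sum>p\<le>a. (\<Sum>i\<le>a. F $ i * \<phi> ^ i $ p) * w $ (a - p))"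
    by (intro sum.cong refl arg_cong2[of _ _ _ _ "(*)"] sum.mono_neutral_left)
       (auto simp: startsby_zero_power_prefix[OF \<phi>0])
  also have "\<dots> = (\<Sum>i\<le>a. F $ i * (\<phi> ^ i * w) $ a)"
    unfolding fps_mult_nth sum_distrib_left sum_distrib_right mult.assoc atMost_atLeast0
    by (rule sum.swap)
  also have "\<dots> = (\<Sum>i\<le>a. if i = a then F $ a else 0)"
    by (intro sum.cong) (auto simp: mono[folded w_def])
  also have "\<dots> = F $ a" by simp
  finally show ?thesis by (simp add: w_def mult.assoc)
qed

text \<open>The case F = H^j of \<open>fps_Lagrange\<close>, where F(\<phi>) = X^j merely shifts the
  index.\<close>

lemma fps_Lagrange_power:
  fixes \<phi> \<rho> H :: "'r::{idom, semiring_char_0} fps"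
  assumes \<phi>\<rho>: "\<phi> * \<rho> = fps_X" and \<phi>0: "\<phi> $ 0 = 0" and H\<phi>: "H oo \<phi> = fps_X" and "j \<le> b"
  shows "of_nat b * H ^ j $ b = of_nat j * \<rho> ^ b $ (b - j)"
proof -
  have "H ^ j $ b = (fps_X ^ j * (fps_deriv \<phi> * \<rho> ^ Suc b)) $ b"
    using fps_Lagrange[OF \<phi>\<rho> \<phi>0, of "H ^ j" b]
    by (simp add: H\<phi> mult.assoc flip: fps_compose_power[OF \<phi>0])
  also have "\<dots> = (fps_deriv \<phi> * \<rho> ^ Suc b) $ (b - j)"
    using \<open>j \<le> b\<close> by (simp add: fps_X_power_mult_nth del: power_Suc)
  finally show ?thesis
    using fps_deriv_mult_power_nth[OF \<phi>\<rho>, of b "b - j"] \<open>j \<le> b\<close> by (simp add: of_nat_diff)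
qed

section \<open>Divided differences and Grunsky coefficients\<close>

text \<open>The coefficients come from (t^(n+1) - s^(n+1)) / (t - s) being the sum of t^a s^b over a
  + b = n; giving them directly avoids a division by the non-unit t - s.\<close>

definition fps_divdiff :: "'b::comm_ring_1 fps \<Rightarrow> 'b fps fps" where
  "fps_divdiff H = Abs_fps (\<lambda>a. Abs_fps (\<lambda>b. H $ Suc (a + b)))"

lemma fps_divdiff_nth [simp]: "fps_divdiff H $ a $ b = H $ Suc (a + b)"
  by (simp add: fps_divdiff_def)

lemma fps_divdiff_mult:
  "(fps_X - fps_const fps_X) * fps_divdiff H = fps_lift H - fps_const H"
proof (intro fps_ext)
  fix a b
  show "((fps_X - fps_const fps_X) * fps_divdiff H) $ a $ b = (fps_lift H - fps_const H) $ a $ b"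
    by (cases a; cases b) (simp_all add: left_diff_distrib)
qed

lemma fps_eval2_divdiff_nth:
  "fps_eval2 \<alpha> \<beta> (fps_divdiff H) $ n = (\<Sum>i\<le>n. \<alpha> ^ i * \<beta> ^ (n - i)) * H $ Suc n"
  by (simp add: fps_eval2_nth sum_distrib_right)

text \<open>For roots of unity \<alpha>, \<beta> this factors a difference of two solutions; with
  one of them 0 it factors a single solution.\<close>

lemma fps_eval2_divdiff_mult:
  "fps_const (\<alpha> - \<beta>) * fps_X * fps_eval2 \<alpha> \<beta> (fps_divdiff H)
     = (H oo fps_const \<alpha> * fps_X) - (H oo fps_const \<beta> * fps_X)"
proof (rule fps_ext)
  fix n
  show "(fps_const (\<alpha> - \<beta>) * fps_X * fps_eval2 \<alpha> \<beta> (fps_divdiff H)) $ n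
     = ((H oo fps_const \<alpha> * fps_X) - (H oo fps_const \<beta> * fps_X)) $ n"
  proof (cases n)
    case (Suc m)
    have "\<alpha> ^ Suc m - \<beta> ^ Suc m = (\<alpha> - \<beta>) * (\<Sum>i\<le>m. \<alpha> ^ i * \<beta> ^ (m - i))"
      by (simp add: power_diff_sumr2 lessThan_Suc_atMost mult.commute del: power_Suc)
    from arg_cong[OF this, of "\<lambda>x. x * H $ Suc m"] show ?thesis
      by (simp add: Suc fps_eval2_divdiff_nth left_diff_distrib mult.assoc)
  qed (simp add: mult.assoc)
qed

text \<open>
  With \<open>Q\<close> the divided difference of \<open>H\<close>, this series is \<open>1 + (t \<partial>\<^sub>t + s \<partial>\<^sub>s) Q / Q\<close>.
\<close>

definition grunsky :: "'b::field fps \<Rightarrow> 'b fps fps" where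
  "grunsky H = fps_divdiff (fps_X * fps_deriv H) *
     fps_right_inverse (fps_divdiff H) (inverse (fps_divdiff H $ 0))"

text \<open>The coefficients with respect to t are power series in s, not field elements. The
  leading one is a unit because its constant term is \<open>H $ 1\<close>, and it determines a right
  inverse of the divided difference.\<close>

lemma grunsky_mult_divdiff:
  assumes "H $ 1 \<noteq> 0"
  shows "grunsky H * fps_divdiff H = fps_divdiff (fps_X * fps_deriv H)"
proof -
  have "fps_divdiff H * fps_right_inverse (fps_divdiff H) (inverse (fps_divdiff H $ 0)) = 1"
    using assms by (intro fps_right_inverse inverse_mult_eq_1') simp
  thus ?thesis by (simp add: grunsky_def mult_ac)
qed

lemma grunsky_mult_diff:
  assumes "H $ 1 \<noteq> 0"
  shows "(fps_lift H - fps_const H) * grunsky H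
    = fps_lift (fps_X * fps_deriv H) - fps_const (fps_X * fps_deriv H)"
  unfolding fps_divdiff_mult[symmetric] grunsky_mult_divdiff[OF assms, symmetric]
  by (simp add: mult_ac)

text \<open>The operator t d/dt + s d/ds multiplies the part of degree n by n and becomes s d/ds
  after the substitution. Coefficient n + 1 of X H' carries the factor n + 1 instead of n, whence
  the subtracted 1.\<close>

lemma fps_eval2_grunsky:
  assumes "H $ 1 \<noteq> 0"
  shows "fps_X * fps_deriv (fps_eval2 \<alpha> \<beta> (fps_divdiff H))
    = (fps_eval2 \<alpha> \<beta> (grunsky H) - 1) * fps_eval2 \<alpha> \<beta> (fps_divdiff H)"
proof -
  have "fps_eval2 \<alpha> \<beta> (fps_divdiff (fps_X * fps_deriv H))
      = fps_eval2 \<alpha> \<beta> (fps_divdiff H) + fps_X * fps_deriv (fps_eval2 \<alpha> \<beta> (fps_divdiff H))"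
  proof (rule fps_ext)
    fix n
    show "fps_eval2 \<alpha> \<beta> (fps_divdiff (fps_X * fps_deriv H)) $ n
      = (fps_eval2 \<alpha> \<beta> (fps_divdiff H) + fps_X * fps_deriv (fps_eval2 \<alpha> \<beta> (fps_divdiff H))) $ n"
      by (cases n) (simp_all add: fps_eval2_divdiff_nth algebra_simps)
  qed
  thus ?thesis
    by (simp add: algebra_simps fps_eval2_mult flip: grunsky_mult_divdiff[OF assms])
qed

text \<open>Composing with \<phi> in the variable t straightens H(t) to t, and Lagrange inversion in
  t reads off coefficient a. The resulting linear recursion is unrolled into powers of H(s), whose
  coefficients Lagrange inversion in s evaluates.\<close>

lemma grunsky_nth:
  fixes \<phi> \<rho> H :: "'b::field_char_0 fps"
  assumes \<phi>\<rho>: "\<phi> * \<rho> = fps_X" and \<phi>0: "\<phi> $ 0 = 0" and H\<phi>: "H oo \<phi> = fps_X"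
    and H0: "H $ 0 = 0" and H1: "H $ 1 \<noteq> 0" and a: "a > 0" and b: "b > 0"
  shows "of_nat a * of_nat b * grunsky H $ a $ b =
    of_nat (a + b) * (\<Sum>j=1..b. of_nat j * \<rho> ^ a $ (a + j) * \<rho> ^ b $ (b - j))"
proof -
  define w where "w = fps_deriv \<phi> * \<rho> ^ Suc a"
  \<comment> \<open>With C for \<open>grunsky H\<close>, this is C(\<phi>(t), s) times the Lagrange
    weight of index \<open>a\<close>, so its coefficient of t^a is that of C.\<close>
  define Y where "Y = (grunsky H oo fps_lift \<phi>) * fps_lift w"
  define D where "D = fps_X * fps_deriv H"
  have L\<phi>0: "fps_lift \<phi> $ 0 = 0" by (simp add: \<phi>0)
  have CY: "grunsky H $ a = Y $ a"
  proof -
    have "fps_lift \<phi> * fps_lift \<rho> = fps_X"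
      by (simp add: \<phi>\<rho> flip: fps_lift_mult)
    from fps_Lagrange[OF this L\<phi>0, of "grunsky H" a] show ?thesis
      by (simp add: Y_def w_def fps_lift_mult fps_lift_deriv fps_lift_power mult.assoc)
  qed

  have "fps_deriv (H oo \<phi>) = 1"
    by (simp add: H\<phi>)
  hence H'\<phi>: "(fps_deriv H oo \<phi>) * fps_deriv \<phi> = 1"
    by (simp add: fps_compose_deriv[OF \<phi>0])
  have D\<phi>: "(D oo \<phi>) * w = fps_X * \<rho> ^ a"
  proof -
    have "(D oo \<phi>) * w = (\<phi> * \<rho>) * ((fps_deriv H oo \<phi>) * fps_deriv \<phi>) * \<rho> ^ a"
      by (simp add: D_def w_def fps_compose_mult_distrib[OF \<phi>0] \<phi>0 mult_ac)
    thus ?thesis by (simp add: \<phi>\<rho> H'\<phi>)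
  qed
  have "((fps_lift H - fps_const H) * grunsky H) oo fps_lift \<phi>
      = (fps_lift D - fps_const D) oo fps_lift \<phi>"
    by (simp add: grunsky_mult_diff[OF H1] D_def)
  hence "(fps_X - fps_const H) * (grunsky H oo fps_lift \<phi>) = fps_lift (D oo \<phi>) - fps_const D"
    by (simp add: fps_compose_mult_distrib[OF L\<phi>0] fps_compose_sub_distrib H\<phi> flip: fps_lift_compose)
  hence "(fps_X - fps_const H) * (grunsky H oo fps_lift \<phi>) * fps_lift w
      = (fps_lift (D oo \<phi>) - fps_const D) * fps_lift w"
    by simp
  hence Yeq: "(fps_X - fps_const H) * Y = fps_X * fps_lift (\<rho> ^ a) - fps_const D * fps_lift w"
    using fps_lift_mult[of fps_X "\<rho> ^ a"]
    by (simp add: Y_def mult.assoc left_diff_distrib D\<phi> flip: fps_lift_mult)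
  \<comment> \<open>Read off from coefficient \<open>Suc k\<close> in t of \<open>Yeq\<close>: the
    factor t - H(s) links consecutive coefficients of \<open>Y\<close>.\<close>
  have Y_step: "Y $ k = H * Y $ Suc k + (fps_const (\<rho> ^ a $ k) - D * fps_const (w $ Suc k))" for k
  proof -
    have "((fps_X - fps_const H) * Y) $ Suc k
        = (fps_X * fps_lift (\<rho> ^ a) - fps_const D * fps_lift w) $ Suc k"
      by (simp only: Yeq)
    thus ?thesis by (simp add: left_diff_distrib algebra_simps)
  qed
  have Y_exp: "Y $ a = H ^ N * Y $ (a + N) +
      (\<Sum>j<N. H ^ j * (fps_const (\<rho> ^ a $ (a + j)) - D * fps_const (w $ Suc (a + j))))" for N
  proof (induction N)
    case (Suc N)
    show ?case
      unfolding Suc.IH by (subst Y_step[of "a + N"]) (simp add: algebra_simps)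
  qed simp

  \<comment> \<open>H^(b+1) starts beyond s^b, so the remainder disappears from coefficient b after
    b + 1 unrollings of the recursion.\<close>
  have Hb: "H ^ Suc b $ b = 0"
    by (rule startsby_zero_power_prefix[OF H0, rule_format]) simp
  have Hb': "(H ^ Suc b * f) $ b = 0" for f :: "'b fps"
    by (simp add: fps_mult_nth startsby_zero_power_prefix[OF H0, rule_format] del: power_Suc)
  have w_nth: "of_nat a * w $ Suc (a + j) = - of_nat (Suc j) * \<rho> ^ a $ Suc (a + j)" for j
    unfolding w_def by (subst fps_deriv_mult_power_nth[OF \<phi>\<rho>]) simp
  have D_nth: "of_nat (Suc j) * (H ^ j * D) $ b = of_nat b * H ^ Suc j $ b" for j
  proof -
    have "fps_const (of_nat (Suc j)) * (H ^ j * D) = fps_X * fps_deriv (H ^ Suc j)"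
      by (simp only: D_def fps_deriv_power' diff_Suc_1 fps_of_nat mult_ac)
    hence "(fps_const (of_nat (Suc j)) * (H ^ j * D)) $ b = (fps_X * fps_deriv (H ^ Suc j)) $ b"
      by simp
    thus ?thesis
      using b by (cases b) (simp_all del: power_Suc of_nat_Suc)
  qed
  let ?f = "\<lambda>j. H ^ j $ b * \<rho> ^ a $ (a + j)"
  have summand: "of_nat a * (H ^ j * (fps_const (\<rho> ^ a $ (a + j)) - D * fps_const (w $ Suc (a + j)))) $ b
      = of_nat a * ?f j + of_nat b * ?f (Suc j)" for j
  proof -
    have "of_nat a * (H ^ j * (fps_const (\<rho> ^ a $ (a + j)) - D * fps_const (w $ Suc (a + j)))) $ b
        = of_nat a * ?f j - (H ^ j * D) $ b * (of_nat a * w $ Suc (a + j))"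
      unfolding right_diff_distrib mult.assoc[symmetric] fps_sub_nth fps_mult_right_const_nth
      by (simp only: mult_ac)
    also have "\<dots> = of_nat a * ?f j + (of_nat (Suc j) * (H ^ j * D) $ b) * \<rho> ^ a $ Suc (a + j)"
      unfolding w_nth by (simp add: algebra_simps)
    finally show ?thesis by (simp only: D_nth) (simp add: mult_ac)
  qed
  \<comment> \<open>\<open>?f\<close> vanishes at 0 because b > 0 and at b + 1 by \<open>Hb\<close>.
    The shift therefore leaves the sum unchanged, and the weights a and b combine to a + b.\<close>
  have shift: "(\<Sum>j<Suc b. ?f (Suc j)) = (\<Sum>j<Suc b. ?f j)"
  proof -
    have "(\<Sum>j<Suc b. ?f j) + ?f (Suc b) = ?f 0 + (\<Sum>j<Suc b. ?f (Suc j))"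
      by (rule trans[OF sum.lessThan_Suc[of ?f "Suc b", symmetric] sum.lessThan_Suc_shift[of ?f "Suc b"]])
    moreover have "?f (Suc b) = 0" "?f 0 = 0"
      using Hb b by (simp_all del: power_Suc)
    ultimately show ?thesis using b by simp
  qed
  have "of_nat a * grunsky H $ a $ b = of_nat a * Y $ a $ b"
    by (simp add: CY)
  also have "\<dots> = (\<Sum>j<Suc b. of_nat a * ?f j + of_nat b * ?f (Suc j))"
    by (subst Y_exp[of "Suc b"])
       (simp only: fps_add_nth Hb' fps_sum_nth sum_distrib_left add_0_left summand distrib_left mult_zero_right)
  also have "\<dots> = of_nat a * (\<Sum>j<Suc b. ?f j) + of_nat b * (\<Sum>j<Suc b. ?f j)"
    by (simp only: sum.distrib sum_distrib_left[symmetric] shift)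
  also have "\<dots> = of_nat (a + b) * (\<Sum>j<Suc b. ?f j)"
    by (simp add: algebra_simps)
  also have "(\<Sum>j<Suc b. ?f j) = (\<Sum>j=1..b. ?f j)"
    using b by (intro sum.mono_neutral_right) (auto simp: Suc_le_eq)
  finally have "of_nat b * (of_nat a * grunsky H $ a $ b)
      = of_nat b * (of_nat (a + b) * (\<Sum>j=1..b. ?f j))"
    by (simp only:)
  hence "of_nat a * of_nat b * grunsky H $ a $ b
      = of_nat (a + b) * (\<Sum>j=1..b. (of_nat b * H ^ j $ b) * \<rho> ^ a $ (a + j))"
    unfolding sum_distrib_left by (simp only: mult_ac)
  also have "(\<Sum>j=1..b. (of_nat b * H ^ j $ b) * \<rho> ^ a $ (a + j))
      = (\<Sum>j=1..b. of_nat j * \<rho> ^ a $ (a + j) * \<rho> ^ b $ (b - j))"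
    by (intro sum.cong refl) (simp add: fps_Lagrange_power[OF \<phi>\<rho> \<phi>0 H\<phi>])
  finally show ?thesis .
qed

section \<open>Roots of unity\<close>

lemma finite_roots_of_unity:
  fixes e :: nat
  assumes "e > 0"
  shows "finite {w :: 'b::idom. w ^ e = 1}"
proof -
  have "finite {w :: 'b. poly (monom 1 e - 1) w = 0}"
    using assms by (intro poly_roots_finite) (auto simp: poly_eq_iff dest!: spec[of _ e])
  thus ?thesis by (simp add: poly_monom)
qed

text \<open>If z in \<open>W\<close> has z^a different from 1, multiplication by z permutes
  \<open>W\<close> but scales the sum by z^a, so the sum is 0. The hypothesis \<open>card_W\<close>
  says that the field contains a full set of e-th roots of unity.\<close>

lemma sum_power_roots_of_unity:
  fixes e a :: nat
  defines "W \<equiv> {w :: 'b::field. w ^ e = 1}"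
  assumes e: "e > 0" and card_W: "card W = e"
  shows "(\<Sum>w\<in>W. w ^ a) = (if e dvd a then of_nat e else 0)"
proof (cases "e dvd a")
  case True
  hence "w ^ a = 1" if "w \<in> W" for w
    using that by (auto simp: W_def power_mult)
  thus ?thesis using True by (simp add: card_W)
next
  case False
  define r where "r = a mod e"
  have r: "0 < r" "r < e"
    using False e by (auto simp: r_def dvd_eq_mod_eq_0)
  have pow_r: "w ^ a = w ^ r" if "w \<in> W" for w
  proof -
    have "w ^ a = w ^ (e * (a div e) + r)" by (simp add: r_def)
    also have "\<dots> = w ^ r" using that by (simp add: W_def power_add power_mult)
    finally show ?thesis .
  qed
  \<comment> \<open>Otherwise all e elements of \<open>W\<close> would be roots of X^r - 1, whose
    degree r is smaller than e.\<close>
  have "\<exists>z\<in>W. z ^ r \<noteq> 1"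
  proof (rule ccontr)
    assume "\<not> ?thesis"
    hence sub: "W \<subseteq> {w. poly (monom 1 r - 1) w = 0}"
      by (auto simp: poly_monom)
    have nz: "monom 1 r - 1 \<noteq> (0 :: 'b poly)"
      using r by (auto simp: poly_eq_iff dest!: spec[of _ r])
    have "card W \<le> degree (monom 1 r - 1 :: 'b poly)"
      by (rule le_trans[OF card_mono[OF poly_roots_finite[OF nz] sub] card_poly_roots_bound[OF nz]])
    also have "\<dots> \<le> r"
      by (intro degree_diff_le) (auto simp: degree_monom_le)
    finally show False using r card_W by simp
  qed
  then obtain z where z: "z \<in> W" "z ^ a \<noteq> 1"
    using pow_r by metis
  hence z0: "z \<noteq> 0" using e by (auto simp: W_def power_0_left)
  have "(\<Sum>w\<in>W. w ^ a) = (\<Sum>w\<in>W. (z * w) ^ a)"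
    using z z0 by (intro sum.reindex_bij_witness[of _ "\<lambda>w. z * w" "\<lambda>w. w / z"])
      (auto simp: W_def power_mult_distrib power_divide)
  also have "\<dots> = z ^ a * (\<Sum>w\<in>W. w ^ a)"
    by (simp add: power_mult_distrib sum_distrib_left)
  finally show ?thesis using z False by simp
qed

text \<open>X^e - 1 splits into linear factors over an algebraically closed field. Its roots are
  simple, since its derivative can vanish only at 0, which is not a root.\<close>

lemma card_roots_of_unity:
  fixes e :: nat
  assumes e: "e > 0"
  shows "card {w :: 'b::{alg_closed_field, field_char_0}. w ^ e = 1} = e"
proof -
  define p :: "'b poly" where "p = monom 1 e - 1"
  have deg: "degree p = e"
    using e unfolding p_def
    by (intro antisym degree_diff_le le_degree) (simp_all add: degree_monom_le)
  hence p0: "p \<noteq> 0" using e by auto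
  have roots: "{x. poly p x = 0} = {w. w ^ e = 1}"
    by (simp add: p_def poly_monom)
  have "rsquarefree p"
    unfolding rsquarefree_roots using e
    by (auto simp: p_def poly_monom pderiv_diff pderiv_monom power_0_left)
  obtain A where A: "size A = degree p" "p = smult (lead_coeff p) (\<Prod>x\<in>#A. [:-x, 1:])"
    using alg_closed_imp_factorization[OF p0] by blast
  have "proots (\<Prod>x\<in>#A. [:-x, 1:]) = A"
  proof (induction A)
    case (add x A)
    have "(\<Prod>x\<in>#A. [:-x, 1:]) \<noteq> 0"
      by (auto simp: prod_mset_zero_iff)
    hence "proots ([:-x, 1:] * (\<Prod>x\<in>#A. [:-x, 1:])) = {#x#} + A"
      using add.IH by (subst proots_mult) simp_all
    thus ?case by simp
  qed simp
  hence "proots p = A"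
    by (subst A(2), subst proots_smult) (simp_all add: p0)
  hence "e = size (proots p)"
    using A(1) deg by simp
  also have "\<dots> = (\<Sum>x | poly p x = 0. order x p)"
    by (simp add: size_multiset_overloaded_eq p0)
  also have "\<dots> = (\<Sum>x | poly p x = 0. 1)"
    by (intro sum.cong refl) (simp add: rsquarefree_root_order[OF \<open>rsquarefree p\<close> _ p0])
  finally show ?thesis by (simp add: roots)
qed

text \<open>Both sides are the derivative of X^e - 1 at k: in the product rule for its factorisation
  over \<open>W\<close>, only the summand omitting the factor of k survives.\<close>

lemma prod_diff_roots_of_unity:
  fixes e :: nat
  defines "W \<equiv> {w :: 'b::field. w ^ e = 1}"
  assumes e: "e > 0" and card_W: "card W = e" and k: "k \<in> W"
  shows "(\<Prod>i\<in>W - {k}. k - i) = of_nat e * k ^ (e - 1)"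
proof -
  have fin: "finite W"
    unfolding W_def by (rule finite_roots_of_unity[OF e])
  define P where "P = (\<Prod>w\<in>W. [:-w, 1:])"
  have degP: "degree P = e"
    by (simp add: P_def degree_prod_sum_eq card_W)
  \<comment> \<open>Two polynomials of degree at most e with the same coefficient of X^e coincide
    once they agree at the e points of \<open>W\<close>.\<close>
  have "monom 1 e - 1 = P"
  proof (rule poly_eqI_degree_lead_coeff)
    have "lead_coeff P = 1" by (simp add: P_def lead_coeff_prod)
    thus "coeff (monom 1 e - 1) e = coeff P e"
      using e by (simp add: degP)
    show "degree (monom 1 e - 1 :: 'b poly) \<le> e"
      by (intro degree_diff_le) (simp_all add: degree_monom_le)
    show "poly (monom 1 e - 1) z = poly P z" if "z \<in> W" for z
    proof -
      have "poly P z = 0"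
        using that fin by (auto simp: P_def poly_prod intro!: prod_zero)
      thus ?thesis using that by (simp add: W_def poly_monom)
    qed
  qed (simp_all add: degP card_W)
  hence "of_nat e * k ^ (e - 1) = poly (pderiv P) k"
    by (auto simp: pderiv_diff pderiv_monom poly_monom)
  also have "\<dots> = (\<Sum>a\<in>W. \<Prod>w\<in>W - {a}. k - w)"
    by (simp add: P_def pderiv_prod pderiv_pCons poly_sum poly_prod)
  also have "\<dots> = (\<Sum>a\<in>{k}. \<Prod>w\<in>W - {a}. k - w)"
    using fin k by (intro sum.mono_neutral_right) (auto intro!: prod_zero)
  finally show ?thesis by simp
qed

section \<open>The product formula\<close>

text \<open>Logarithmic derivatives add over a product; the multiplied-out form avoids
  quotients.\<close>

lemma fps_X_deriv_prod:
  fixes f g :: "'i \<Rightarrow> 'b::comm_ring_1 fps"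
  assumes "\<And>i. i \<in> I \<Longrightarrow> fps_X * fps_deriv (f i) = g i * f i"
  shows "fps_X * fps_deriv (\<Prod>i\<in>I. f i) = (\<Sum>i\<in>I. g i) * (\<Prod>i\<in>I. f i)"
  using assms
proof (induction I rule: infinite_finite_induct)
  case (insert i I)
  have "fps_X * fps_deriv (\<Prod>i\<in>insert i I. f i)
      = (fps_X * fps_deriv (f i)) * prod f I + f i * (fps_X * fps_deriv (prod f I))"
    using insert.hyps by (simp add: algebra_simps)
  also have "\<dots> = (g i * f i) * prod f I + f i * (sum g I * prod f I)"
    using insert by (simp only: insertI1 insertI2)
  finally show ?case
    using insert.hyps by (simp add: algebra_simps)
qed auto

text \<open>The nonzero constant term of h forces g(0) = 0. Coefficient n of the difference d of two
  solutions then satisfies n d_n = sum of g_i d_(n-i) over i > 0, so d vanishes by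
  induction.\<close>

lemma fps_X_deriv_unique:
  fixes f g h :: "'b::field_char_0 fps"
  assumes f: "fps_X * fps_deriv f = g * f" and h: "fps_X * fps_deriv h = g * h"
    and eq0: "f $ 0 = h $ 0" and nz: "h $ 0 \<noteq> 0"
  shows "f = h"
proof -
  have "(fps_X * fps_deriv h) $ 0 = (g * h) $ 0"
    by (simp only: h)
  hence g0: "g $ 0 = 0"
    using nz by simp
  define d where "d = f - h"
  have d: "fps_X * fps_deriv d = g * d"
    by (simp add: d_def f h right_diff_distrib)
  have "d $ n = 0" for n
  proof (induction n rule: less_induct)
    case (less n)
    show ?case
    proof (cases n)
      case 0
      thus ?thesis by (simp add: d_def eq0)
    next
      case (Suc m)
      have "of_nat n * d $ n = (fps_X * fps_deriv d) $ n"
        by (simp add: Suc)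
      also have "\<dots> = (\<Sum>i=0..n. g $ i * d $ (n - i))"
        by (simp add: d fps_mult_nth)
      also have "\<dots> = 0"
      proof (intro sum.neutral ballI)
        fix i assume "i \<in> {0..n}"
        thus "g $ i * d $ (n - i) = 0"
          using less.IH[of "n - i"] g0 Suc by (cases "i = 0") auto
      qed
      finally show ?thesis by (simp add: Suc del: of_nat_Suc)
    qed
  qed
  hence "d = 0"
    by (simp add: fps_eq_iff)
  thus ?thesis by (simp add: d_def)
qed

section \<open>The exponent of \<open>G\<close> as a sum over roots of unity\<close>

text \<open>Eliminating n = N - m turns the sum over triples into an iterated sum over finite
  intervals.\<close>

lemma G_exponent_nth:
  "G_exponent e R $ N = - (\<Sum>m=1..<N. \<Sum>j=1..(N-m)*e.
     of_nat j * (1 / of_nat m * R ^ m $ (m * e + j)) *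
       (1 / of_nat (N - m) * R ^ (N - m) $ ((N - m) * e - j)))"
proof -
  have "(\<Sum>(n, m, j) \<in> {(n, m, j). n > 0 \<and> m > 0 \<and> j > 0 \<and> n + m = N \<and> j \<le> n * e}.
       of_nat j * (1 / of_nat m * R ^ m $ (m * e + j)) * (1 / of_nat n * R ^ n $ (n * e - j)))
    = (\<Sum>(m, j) \<in> (SIGMA m:{1..<N}. {1..(N-m)*e}). of_nat j * (1 / of_nat m * R ^ m $ (m * e + j)) *
       (1 / of_nat (N - m) * R ^ (N - m) $ ((N - m) * e - j)))"
    by (rule sum.reindex_bij_witness[of _ "\<lambda>(m, j). (N - m, m, j)" "\<lambda>(n, m, j). (m, j)"]) auto
  also have "\<dots> = (\<Sum>m=1..<N. \<Sum>j=1..(N-m)*e.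
      of_nat j * (1 / of_nat m * R ^ m $ (m * e + j)) *
       (1 / of_nat (N - m) * R ^ (N - m) $ ((N - m) * e - j)))"
    by (subst sum.Sigma) auto
  finally show ?thesis
    by (simp only: G_exponent_def fps_neg_nth fps_nth_Abs_fps)
qed

lemma fps_prod_nth_0: "(\<Prod>i\<in>I. f i) $ 0 = (\<Prod>i\<in>I. f i $ 0)"
  by (induction I rule: infinite_finite_induct) simp_all

lemma fps_eval2_const_term: "fps_eval2 \<alpha> \<beta> A $ 0 = A $ 0 $ 0"
  by (simp add: fps_eval2_nth)

text \<open>This separates the pure powers of t and s from the mixed monomials. Evaluation with an
  argument 0 isolates a pure power, because 0^0 = 1 while positive powers of 0 vanish.\<close>

lemma fps_eval2_nth_pos:
  assumes "n > 0"
  shows "fps_eval2 \<alpha> \<beta> A $ n = fps_eval2 \<alpha> 0 A $ n + fps_eval2 0 \<beta> A $ n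
    + (\<Sum>i=1..<n. \<alpha> ^ i * \<beta> ^ (n - i) * A $ i $ (n - i))"
proof -
  have split: "(\<Sum>i\<le>n. f i) = f n + f 0 + (\<Sum>i=1..<n. f i)" for f :: "nat \<Rightarrow> 'a"
  proof -
    have "{..n} = insert n (insert 0 {1..<n})" using assms by auto
    thus ?thesis using assms by (simp add: add.assoc)
  qed
  have "(\<Sum>i=1..<n. \<alpha> ^ i * 0 ^ (n - i) * A $ i $ (n - i)) = 0"
    by (intro sum.neutral) (auto simp: power_0_left)
  moreover have "(\<Sum>i=1..<n. 0 ^ i * \<beta> ^ (n - i) * A $ i $ (n - i)) = 0"
    by (intro sum.neutral) (auto simp: power_0_left)
  ultimately show ?thesis
    unfolding fps_eval2_nth split using assms by (simp add: power_0_left)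
qed

text \<open>The alternating combination retains only monomials t^a s^b with a, b > 0. Summation over
  the roots of unity keeps those with e dividing both a and b, with weight e^2, and
  \<open>grunsky_nth\<close> identifies their coefficients with the terms of the exponent.\<close>

lemma sum_grunsky_nth:
  fixes \<phi> \<rho> H :: "'b::field_char_0 fps" and e :: nat
  defines "W \<equiv> {w :: 'b. w ^ e = 1}"
  defines "c \<equiv> \<lambda>\<alpha> \<beta>. fps_eval2 \<alpha> \<beta> (grunsky H)"
  assumes \<phi>\<rho>: "\<phi> * \<rho> = fps_X" and \<phi>0: "\<phi> $ 0 = 0" and H\<phi>: "H oo \<phi> = fps_X"
    and H0: "H $ 0 = 0" and H1: "H $ 1 \<noteq> 0"
    and e: "e > 0" and card_W: "card W = e"
  shows "(\<Sum>k\<in>W. \<Sum>i\<in>W. c k i - c k 0 - c 0 i + c 0 0)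
    = - (fps_X * fps_deriv (G_exponent e (\<rho> ^ e) oo fps_X ^ e))"
proof (rule fps_ext)
  fix n
  let ?E = "G_exponent e (\<rho> ^ e)"
  have E_nth: "(fps_X * fps_deriv (?E oo fps_X ^ e)) $ n
      = (if e dvd n then of_nat n * ?E $ (n div e) else 0)"
    by (cases n) (auto simp: fps_nth_compose_X_power)
  show "(\<Sum>k\<in>W. \<Sum>i\<in>W. c k i - c k 0 - c 0 i + c 0 0) $ n
    = (- (fps_X * fps_deriv (?E oo fps_X ^ e))) $ n"
  proof (cases "n = 0")
    case True
    thus ?thesis by (simp add: fps_sum_nth c_def fps_eval2_const_term)
  next
    case False
    hence n: "n > 0" by simp
    define C where "C = (\<lambda>a. grunsky H $ a $ (n - a))"
    have c00: "c 0 0 $ n = 0"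
      using n by (auto simp: c_def fps_eval2_nth power_0_left intro!: sum.neutral)
    have "(c k i - c k 0 - c 0 i + c 0 0) $ n = (\<Sum>a=1..<n. k ^ a * i ^ (n - a) * C a)" for k i
      using fps_eval2_nth_pos[OF n, of k i "grunsky H"] c00 by (simp add: c_def C_def)
    hence "(\<Sum>k\<in>W. \<Sum>i\<in>W. c k i - c k 0 - c 0 i + c 0 0) $ n
        = (\<Sum>k\<in>W. \<Sum>i\<in>W. \<Sum>a=1..<n. k ^ a * i ^ (n - a) * C a)"
      by (simp only: fps_sum_nth)
    also have "\<dots> = (\<Sum>k\<in>W. \<Sum>a=1..<n. \<Sum>i\<in>W. k ^ a * i ^ (n - a) * C a)"
      by (intro sum.cong refl sum.swap)
    also have "\<dots> = (\<Sum>a=1..<n. \<Sum>k\<in>W. \<Sum>i\<in>W. k ^ a * i ^ (n - a) * C a)"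
      by (rule sum.swap)
    also have "\<dots> = (\<Sum>a=1..<n. (\<Sum>k\<in>W. k ^ a) * (\<Sum>i\<in>W. i ^ (n - a)) * C a)"
      by (simp only: sum_product) (simp only: sum_distrib_right)
    also have "\<dots> = (\<Sum>a=1..<n. if e dvd a \<and> e dvd (n - a) then of_nat e ^ 2 * C a else 0)"
      using card_W unfolding W_def
      by (intro sum.cong refl) (simp add: sum_power_roots_of_unity[OF e] power2_eq_square)
    also have "\<dots> = (- (fps_X * fps_deriv (?E oo fps_X ^ e))) $ n"
    proof (cases "e dvd n")
      case False
      hence "\<not> (e dvd a \<and> e dvd (n - a))" if "a \<in> {1..<n}" for a
        using that by (metis atLeastLessThan_iff dvd_add le_add_diff_inverse less_imp_le)
      hence "(\<Sum>a=1..<n. if e dvd a \<and> e dvd (n - a) then of_nat e ^ 2 * C a else 0) = 0"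
        by (intro sum.neutral) auto
      thus ?thesis using False by (simp only: fps_neg_nth E_nth) simp
    next
      case True
      then obtain N where N: "n = N * e" by (metis dvdE mult.commute)
      \<comment> \<open>For n = N e the surviving indices are a = m e with 0 < m < N.\<close>
      have "(\<Sum>a=1..<n. if e dvd a \<and> e dvd (n - a) then of_nat e ^ 2 * C a else 0)
          = (\<Sum>a\<in>(\<lambda>m. m * e) ` {1..<N}. of_nat e ^ 2 * C a)"
      proof (rule sum.mono_neutral_cong_right)
        show "\<forall>a\<in>{1..<n} - (\<lambda>m. m * e) ` {1..<N}.
            (if e dvd a \<and> e dvd (n - a) then of_nat e ^ 2 * C a else 0) = 0"
        proof
          fix a assume a: "a \<in> {1..<n} - (\<lambda>m. m * e) ` {1..<N}"
          have "\<not> e dvd a"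
          proof
            assume "e dvd a"
            then obtain m where m: "a = m * e" by (metis dvdE mult.commute)
            hence "m \<in> {1..<N}" using a N by (auto simp: Suc_le_eq)
            thus False using a m by blast
          qed
          thus "(if e dvd a \<and> e dvd (n - a) then of_nat e ^ 2 * C a else 0) = 0" by simp
        qed
        show "(\<lambda>m. m * e) ` {1..<N} \<subseteq> {1..<n}"
          using e by (auto simp: N Suc_le_eq)
      qed (auto simp: N)
      also have "\<dots> = (\<Sum>m=1..<N. of_nat e ^ 2 * C (m * e))"
        using e by (subst sum.reindex) (auto simp: inj_on_def)
      also have "\<dots> = (\<Sum>m=1..<N. of_nat n * (\<Sum>j=1..(N-m)*e.
          of_nat j * (1 / of_nat m * (\<rho> ^ e) ^ m $ (m * e + j)) *
          (1 / of_nat (N - m) * (\<rho> ^ e) ^ (N - m) $ ((N - m) * e - j))))"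
      proof (intro sum.cong refl)
        fix m assume m: "m \<in> {1..<N}"
        define k where "k = N - m"
        have mk: "m > 0" "k > 0" "N = m + k" using m by (auto simp: k_def)
        have "of_nat (m * e) * of_nat (k * e) * grunsky H $ (m * e) $ (k * e)
            = of_nat n * (\<Sum>j=1..k*e. of_nat j * \<rho> ^ (m * e) $ (m * e + j) * \<rho> ^ (k * e) $ (k * e - j))"
          using grunsky_nth[OF \<phi>\<rho> \<phi>0 H\<phi> H0 H1, of "m * e" "k * e"] mk e
          by (simp add: N add_mult_distrib)
        also have "grunsky H $ (m * e) $ (k * e) = C (m * e)"
          by (simp add: C_def N k_def diff_mult_distrib)
        \<comment> \<open>Of the factor (m e) (k e), the part e^2 is exactly the weight from the
          roots of unity; dividing by m k supplies the two reciprocals in the exponent.\<close>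
        finally have "of_nat e ^ 2 * C (m * e)
            = of_nat n * ((1 / of_nat m) * (1 / of_nat k) *
              (\<Sum>j=1..k*e. of_nat j * \<rho> ^ (m * e) $ (m * e + j) * \<rho> ^ (k * e) $ (k * e - j)))"
          using mk by (simp add: field_simps power2_eq_square)
        also have "(1 / of_nat m) * (1 / of_nat k) *
              (\<Sum>j=1..k*e. of_nat j * \<rho> ^ (m * e) $ (m * e + j) * \<rho> ^ (k * e) $ (k * e - j))
            = (\<Sum>j=1..k*e. of_nat j * (1 / of_nat m * (\<rho> ^ e) ^ m $ (m * e + j)) *
               (1 / of_nat k * (\<rho> ^ e) ^ k $ (k * e - j)))"
          unfolding sum_distrib_left by (simp add: mult_ac flip: power_mult)
        finally show "of_nat e ^ 2 * C (m * e) = of_nat n * (\<Sum>j=1..(N-m)*e.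
            of_nat j * (1 / of_nat m * (\<rho> ^ e) ^ m $ (m * e + j)) *
            (1 / of_nat (N - m) * (\<rho> ^ e) ^ (N - m) $ ((N - m) * e - j)))"
          by (simp only: k_def)
      qed
      also have "\<dots> = - (of_nat n * ?E $ N)"
        by (simp add: G_exponent_nth sum_distrib_left)
      also have "\<dots> = (- (fps_X * fps_deriv (?E oo fps_X ^ e))) $ n"
        using e by (simp only: fps_neg_nth E_nth) (simp add: N)
      finally show ?thesis .
    qed
    finally show ?thesis .
  qed
qed

text \<open>Both sides satisfy the same equation X f' = g f and have the constant term
  \<open>H $ 1\<close> to the power 2 e^2, so \<open>fps_X_deriv_unique\<close> applies.\<close>

lemma prod_divdiff_eq:
  fixes \<phi> \<rho> H :: "'b::field_char_0 fps" and e :: nat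
  defines "W \<equiv> {w :: 'b. w ^ e = 1}"
  defines "q \<equiv> \<lambda>\<alpha> \<beta>. fps_eval2 \<alpha> \<beta> (fps_divdiff H)"
  assumes \<phi>\<rho>: "\<phi> * \<rho> = fps_X" and \<phi>0: "\<phi> $ 0 = 0" and H\<phi>: "H oo \<phi> = fps_X"
    and H0: "H $ 0 = 0" and H1: "H $ 1 \<noteq> 0"
    and e: "e > 0" and card_W: "card W = e"
  shows "(\<Prod>k\<in>W. \<Prod>i\<in>W. q k 0 * q 0 i)
    = (G e (\<rho> ^ e) oo fps_X ^ e) * (\<Prod>k\<in>W. \<Prod>i\<in>W. q k i * q 0 0)"
proof (rule fps_X_deriv_unique)
  define c where "c = (\<lambda>\<alpha> \<beta>. fps_eval2 \<alpha> \<beta> (grunsky H))"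
  let ?E = "G_exponent e (\<rho> ^ e) oo fps_X ^ e"
  have q: "fps_X * fps_deriv (q \<alpha> \<beta>) = (c \<alpha> \<beta> - 1) * q \<alpha> \<beta>" for \<alpha> \<beta>
    unfolding q_def c_def by (rule fps_eval2_grunsky[OF H1])
  have q2: "fps_X * fps_deriv (q \<alpha> \<beta> * q \<gamma> \<delta>) = (c \<alpha> \<beta> + c \<gamma> \<delta> - 2) * (q \<alpha> \<beta> * q \<gamma> \<delta>)"
    for \<alpha> \<beta> \<gamma> \<delta>
  proof -
    have "fps_X * fps_deriv (q \<alpha> \<beta> * q \<gamma> \<delta>)
        = (fps_X * fps_deriv (q \<alpha> \<beta>)) * q \<gamma> \<delta> + q \<alpha> \<beta> * (fps_X * fps_deriv (q \<gamma> \<delta>))"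
      by (simp add: algebra_simps)
    thus ?thesis unfolding q by (simp add: algebra_simps)
  qed
  show "fps_X * fps_deriv (\<Prod>k\<in>W. \<Prod>i\<in>W. q k 0 * q 0 i)
      = (\<Sum>k\<in>W. \<Sum>i\<in>W. c k 0 + c 0 i - 2) * (\<Prod>k\<in>W. \<Prod>i\<in>W. q k 0 * q 0 i)"
    by (intro fps_X_deriv_prod q2)
  have E0: "G_exponent e (\<rho> ^ e) $ 0 = 0"
    by (simp add: G_exponent_nth)
  \<comment> \<open>Moving X^e into the exponent makes the logarithmic derivative of this series the
    one computed in \<open>sum_grunsky_nth\<close>.\<close>
  have G: "G e (\<rho> ^ e) oo fps_X ^ e = fps_exp 1 oo ?E"
    unfolding G_def using e by (intro fps_compose_assoc[symmetric] E0) simp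
  have "fps_X * fps_deriv (fps_exp 1 oo ?E) = (fps_X * fps_deriv ?E) * (fps_exp 1 oo ?E)"
    by (subst fps_compose_deriv) (simp_all add: E0)
  also have "fps_X * fps_deriv ?E = - (\<Sum>k\<in>W. \<Sum>i\<in>W. c k i - c k 0 - c 0 i + c 0 0)"
    using sum_grunsky_nth[OF \<phi>\<rho> \<phi>0 H\<phi> H0 H1 e card_W[unfolded W_def]]
    by (simp add: W_def c_def)
  finally have dG: "fps_X * fps_deriv (G e (\<rho> ^ e) oo fps_X ^ e)
      = - (\<Sum>k\<in>W. \<Sum>i\<in>W. c k i - c k 0 - c 0 i + c 0 0) * (G e (\<rho> ^ e) oo fps_X ^ e)"
    by (simp only: G)
  define P where "P = (\<Prod>k\<in>W. \<Prod>i\<in>W. q k i * q 0 0)"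
  have dP: "fps_X * fps_deriv P = (\<Sum>k\<in>W. \<Sum>i\<in>W. c k i + c 0 0 - 2) * P"
    unfolding P_def by (intro fps_X_deriv_prod q2)
  have factor: "- S * g * P + g * (T * P) = (- S + T) * (g * P)" for S T g :: "'b fps"
    by (simp add: algebra_simps)
  have "fps_X * fps_deriv ((G e (\<rho> ^ e) oo fps_X ^ e) * P)
      = (fps_X * fps_deriv (G e (\<rho> ^ e) oo fps_X ^ e)) * P
        + (G e (\<rho> ^ e) oo fps_X ^ e) * (fps_X * fps_deriv P)"
    by (simp add: algebra_simps)
  also have "\<dots> = (- (\<Sum>k\<in>W. \<Sum>i\<in>W. c k i - c k 0 - c 0 i + c 0 0)
        + (\<Sum>k\<in>W. \<Sum>i\<in>W. c k i + c 0 0 - 2)) * ((G e (\<rho> ^ e) oo fps_X ^ e) * P)"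
    unfolding dG dP by (rule factor)
  \<comment> \<open>The terms \<open>c k i\<close> and \<open>c 0 0\<close> cancel, leaving the
    logarithmic derivative of the left-hand product.\<close>
  also have "- (\<Sum>k\<in>W. \<Sum>i\<in>W. c k i - c k 0 - c 0 i + c 0 0)
        + (\<Sum>k\<in>W. \<Sum>i\<in>W. c k i + c 0 0 - 2) = (\<Sum>k\<in>W. \<Sum>i\<in>W. c k 0 + c 0 i - 2)"
    unfolding sum_negf[symmetric] sum.distrib[symmetric]
    by (intro sum.cong refl) (simp add: algebra_simps)
  finally show "fps_X * fps_deriv ((G e (\<rho> ^ e) oo fps_X ^ e) * (\<Prod>k\<in>W. \<Prod>i\<in>W. q k i * q 0 0))
      = (\<Sum>k\<in>W. \<Sum>i\<in>W. c k 0 + c 0 i - 2)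
        * ((G e (\<rho> ^ e) oo fps_X ^ e) * (\<Prod>k\<in>W. \<Prod>i\<in>W. q k i * q 0 0))"
    unfolding P_def .
  have q0: "q \<alpha> \<beta> $ 0 = H $ 1" for \<alpha> \<beta>
    by (simp add: q_def fps_eval2_const_term)
  have GG0: "(G e (\<rho> ^ e) oo fps_X ^ e) $ 0 = 1"
    by (simp add: G_def)
  show "(\<Prod>k\<in>W. \<Prod>i\<in>W. q k 0 * q 0 i) $ 0
      = ((G e (\<rho> ^ e) oo fps_X ^ e) * (\<Prod>k\<in>W. \<Prod>i\<in>W. q k i * q 0 0)) $ 0"
    by (simp only: fps_mult_nth_0 GG0 fps_prod_nth_0 q0) simp
  show "((G e (\<rho> ^ e) oo fps_X ^ e) * (\<Prod>k\<in>W. \<Prod>i\<in>W. q k i * q 0 0)) $ 0 \<noteq> 0"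
    using H1 by (simp only: fps_mult_nth_0 GG0 fps_prod_nth_0 q0) simp
qed

section \<open>The solutions and their product formula\<close>

text \<open>The equation reads F^e = (X \<rho>(F))^e, so F = w X \<rho>(F) for some root of unity w.
  Since F = \<phi>(F) \<rho>(F), this means \<phi>(F) = w X, that is F = H(w X).\<close>

lemma fps_power_equation_roots:
  fixes \<rho> \<phi> H :: "'b::field_char_0 fps" and e :: nat
  defines "W \<equiv> {w :: 'b. w ^ e = 1}"
  assumes \<phi>\<rho>: "\<phi> * \<rho> = fps_X" and \<phi>0: "\<phi> $ 0 = 0" and \<rho>0: "\<rho> $ 0 \<noteq> 0"
    and H\<phi>: "H oo \<phi> = fps_X" and \<phi>H: "\<phi> oo H = fps_X" and H0: "H $ 0 = 0"
    and e: "e > 0" and card_W: "card W = e"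
  shows "{F. F $ 0 = 0 \<and> F ^ e = fps_X ^ e * (\<rho> ^ e oo F)} = (\<lambda>w. H oo fps_const w * fps_X) ` W"
proof (intro equalityI subsetI)
  fix F assume "F \<in> (\<lambda>w. H oo fps_const w * fps_X) ` W"
  then obtain w where w: "w ^ e = 1" and F: "F = H oo fps_const w * fps_X"
    by (auto simp: W_def)
  have F0: "F $ 0 = 0" by (simp add: F H0)
  have "(\<phi> * \<rho>) oo F = fps_X oo F" by (simp add: \<phi>\<rho>)
  hence "(\<phi> oo F) * (\<rho> oo F) = F"
    by (simp add: fps_compose_mult_distrib[OF F0] F0)
  moreover have "\<phi> oo F = fps_const w * fps_X"
    by (simp add: F fps_compose_assoc H0 \<phi>H)
  ultimately have "F = fps_const w * fps_X * (\<rho> oo F)"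
    by simp
  hence "F ^ e = (fps_const w * fps_X * (\<rho> oo F)) ^ e"
    by (rule arg_cong)
  also have "\<dots> = fps_X ^ e * (\<rho> ^ e oo F)"
    by (simp add: power_mult_distrib fps_const_power w fps_compose_power[OF F0])
  finally show "F \<in> {F. F $ 0 = 0 \<and> F ^ e = fps_X ^ e * (\<rho> ^ e oo F)}"
    using F0 by simp
next
  fix F assume "F \<in> {F. F $ 0 = 0 \<and> F ^ e = fps_X ^ e * (\<rho> ^ e oo F)}"
  hence F0: "F $ 0 = 0" and Fe: "F ^ e = fps_X ^ e * (\<rho> ^ e oo F)" by auto
  define u where "u = fps_X * (\<rho> oo F)"
  have \<rho>F0: "\<rho> oo F \<noteq> 0"
    using \<rho>0 by (metis fps_compose_nth_0 fps_zero_nth)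
  hence u0: "u \<noteq> 0" by (simp add: u_def)
  have Fu: "F ^ e = u ^ e"
    by (simp add: Fe u_def power_mult_distrib fps_compose_power[OF F0])
  define p where "p = monom 1 e - [:u ^ e:]"
  have degp: "degree p \<le> e"
    unfolding p_def by (intro degree_diff_le) (simp_all add: degree_monom_le)
  have "coeff p e = 1" using e by (simp add: p_def coeff_pCons split: nat.splits)
  hence p0: "p \<noteq> 0" by auto
  have roots: "{y. poly p y = 0} = {y. y ^ e = u ^ e}"
    by (simp add: p_def poly_monom)
  \<comment> \<open>Over the domain of power series, Y^e - u^e has at most e roots, and the e
    distinct multiples w u already exhaust them.\<close>
  have "(\<lambda>w. fps_const w * u) ` W = {y. y ^ e = u ^ e}"
  proof (rule card_seteq)
    show "finite {y. y ^ e = u ^ e}"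
      using poly_roots_finite[OF p0] by (simp only: roots)
    show "(\<lambda>w. fps_const w * u) ` W \<subseteq> {y. y ^ e = u ^ e}"
      by (auto simp: W_def power_mult_distrib fps_const_power)
    have "inj_on (\<lambda>w. fps_const w * u) W"
      using u0 by (auto simp: inj_on_def)
    thus "card {y. y ^ e = u ^ e} \<le> card ((\<lambda>w. fps_const w * u) ` W)"
      using card_poly_roots_bound[OF p0] degp by (simp add: roots card_image card_W)
  qed
  then obtain w where w: "w \<in> W" "F = fps_const w * u"
    using Fu by blast
  have "(\<phi> * \<rho>) oo F = fps_X oo F" by (simp add: \<phi>\<rho>)
  hence "(\<phi> oo F) * (\<rho> oo F) = (fps_const w * fps_X) * (\<rho> oo F)"
    using w(2)[symmetric] by (simp add: fps_compose_mult_distrib[OF F0] F0 u_def mult.assoc)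
  hence "\<phi> oo F = fps_const w * fps_X"
    using \<rho>F0 by simp
  hence "H oo (\<phi> oo F) = H oo fps_const w * fps_X"
    by simp
  hence "F = H oo fps_const w * fps_X"
    by (simp add: fps_compose_assoc[OF F0 \<phi>0] H\<phi> F0)
  thus "F \<in> (\<lambda>w. H oo fps_const w * fps_X) ` W"
    using w(1) by blast
qed

lemma fps_to_fls_prod: "fps_to_fls (\<Prod>i\<in>I. f i) = (\<Prod>i\<in>I. fps_to_fls (f i :: 'b::comm_ring_1 fps))"
  by (induction I rule: infinite_finite_induct) (simp_all add: fls_times_fps_to_fls)

lemma fls_const_prod: "fls_const (\<Prod>i\<in>I. f i) = (\<Prod>i\<in>I. fls_const (f i :: 'b::comm_ring_1))"
  by (induction I rule: infinite_finite_induct) (simp_all flip: fls_const_mult_const)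

text \<open>On the diagonal the divided difference is the derivative: each of the n + 1 monomials of
  degree n contributes \<alpha>^n.\<close>

lemma fps_eval2_divdiff_diag:
  "fps_eval2 \<alpha> \<alpha> (fps_divdiff H) = fps_deriv H oo fps_const \<alpha> * fps_X"
proof (rule fps_ext)
  fix n
  have "(\<Sum>i\<le>n. \<alpha> ^ i * \<alpha> ^ (n - i)) = (\<Sum>i\<le>n. \<alpha> ^ n)"
    by (intro sum.cong refl) (simp flip: power_add)
  thus "fps_eval2 \<alpha> \<alpha> (fps_divdiff H) $ n = (fps_deriv H oo fps_const \<alpha> * fps_X) $ n"
    by (simp add: fps_eval2_divdiff_nth)
qed

text \<open>The logarithmic derivative of the equation, (e / F - R'(F) / R(F)) X F' = e, with
  denominators cleared. It is obtained by differentiating, multiplying by F X, replacing F^e and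
  cancelling X^e.\<close>

lemma fps_power_equation_log_deriv:
  fixes F R :: "'b::field_char_0 fps" and e :: nat
  assumes F0: "F $ 0 = 0" and Fe: "F ^ e = fps_X ^ e * (R oo F)" and e: "e > 0"
  shows "(of_nat e * (R oo F) - F * (fps_deriv R oo F)) * (fps_X * fps_deriv F)
    = of_nat e * F * (R oo F)"
proof -
  obtain d where d: "e = Suc d" using e by (cases e) auto
  have "fps_deriv (F ^ e) = fps_deriv (fps_X ^ e * (R oo F))"
    by (simp only: Fe)
  hence "of_nat e * fps_deriv F * F ^ d
      = of_nat e * fps_X ^ d * (R oo F) + fps_X ^ e * ((fps_deriv R oo F) * fps_deriv F)"
    unfolding fps_deriv_mult fps_deriv_power' fps_compose_deriv[OF F0] by (simp add: d algebra_simps)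
  hence "of_nat e * fps_deriv F * F ^ d * (F * fps_X)
      = (of_nat e * fps_X ^ d * (R oo F) + fps_X ^ e * ((fps_deriv R oo F) * fps_deriv F)) * (F * fps_X)"
    by (rule arg_cong)
  moreover have "of_nat e * fps_deriv F * F ^ d * (F * fps_X) = of_nat e * fps_deriv F * F ^ e * fps_X"
    by (simp add: d mult_ac)
  ultimately have "fps_X ^ e * (of_nat e * (R oo F) * (fps_X * fps_deriv F))
      = fps_X ^ e * (of_nat e * F * (R oo F) + F * (fps_deriv R oo F) * (fps_X * fps_deriv F))"
    unfolding Fe by (simp add: d algebra_simps)
  hence "of_nat e * (R oo F) * (fps_X * fps_deriv F)
      = of_nat e * F * (R oo F) + F * (fps_deriv R oo F) * (fps_X * fps_deriv F)"
    by simp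
  thus ?thesis
    by (simp add: algebra_simps)
qed

text \<open>Every factor becomes a value of the divided difference up to powers of X and roots of
  unity. These extra factors cancel, and \<open>prod_divdiff_eq\<close> evaluates what
  remains.\<close>

lemma G_eq_prod:
  fixes \<phi> \<rho> H :: "'b::field_char_0 fps" and e :: nat
  defines "W \<equiv> {w :: 'b. w ^ e = 1}"
  defines "R \<equiv> \<rho> ^ e"
  defines "h \<equiv> \<lambda>w. H oo fps_const w * fps_X"
  assumes \<phi>\<rho>: "\<phi> * \<rho> = fps_X" and \<phi>0: "\<phi> $ 0 = 0" and \<rho>0: "\<rho> $ 0 \<noteq> 0"
    and H\<phi>: "H oo \<phi> = fps_X" and \<phi>H: "\<phi> oo H = fps_X" and H0: "H $ 0 = 0"
    and e: "e > 0" and card_W: "card W = e"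
  shows "fps_to_fls (G e R oo fps_X ^ e) =
      (\<Prod>w\<in>W. fps_to_fls (R oo h w) / fls_const (R $ 0))
      * (\<Prod>w\<in>W. fps_to_fls (h w) ^ e)
      * (\<Prod>(v, w) \<in> {(v, w). v \<in> W \<and> w \<in> W \<and> v \<noteq> w}. 1 / (fps_to_fls (h w) - fps_to_fls (h v)))
      * (\<Prod>w\<in>W. of_nat e / fps_to_fls (h w)
          - fps_to_fls (fps_deriv R oo h w) / fps_to_fls (R oo h w))"
proof -
  have fin: "finite W"
    unfolding W_def by (rule finite_roots_of_unity[OF e])
  have W0: "w \<noteq> 0" if "w \<in> W" for w
    using that e by (auto simp: W_def power_0_left)
  define q where "q = (\<lambda>\<alpha> \<beta>. fps_to_fls (fps_eval2 \<alpha> \<beta> (fps_divdiff H)))"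
  define f where "f = (\<lambda>w. fps_to_fls (h w))"
  define r where "r = (\<lambda>w. fps_to_fls (R oo h w))"
  define r' where "r' = (\<lambda>w. fps_to_fls (fps_deriv R oo h w))"
  let ?c = "fls_const :: 'b \<Rightarrow> 'b fls" and ?X = "fls_X :: 'b fls"

  have "(\<phi> * \<rho>) oo H = fps_X oo H"
    by (simp add: \<phi>\<rho>)
  hence H_eq: "H = fps_X * (\<rho> oo H)"
    by (simp add: fps_compose_mult_distrib[OF H0] H0 \<phi>H)
  have H1: "H $ 1 = \<rho> $ 0"
    by (subst H_eq) simp
  have H1_nz: "H $ 1 \<noteq> 0"
    using \<rho>0 H1 by simp
  have h0: "h w $ 0 = 0" for w
    by (simp add: h_def H0)
  have h_eq: "h w ^ e = fps_X ^ e * (R oo h w)" if "w \<in> W" for w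
  proof -
    have "h w \<in> {F. F $ 0 = 0 \<and> F ^ e = fps_X ^ e * (\<rho> ^ e oo F)}"
      using that unfolding W_def h_def
      by (subst fps_power_equation_roots[OF \<phi>\<rho> \<phi>0 \<rho>0 H\<phi> \<phi>H H0 e card_W[unfolded W_def]]) blast
    thus ?thesis by (simp add: R_def)
  qed

  have f_diff: "f v - f w = ?c (v - w) * ?X * q v w" for v w
    using arg_cong[OF fps_eval2_divdiff_mult[of v w H], of fps_to_fls]
    by (simp add: f_def h_def q_def fls_times_fps_to_fls)
  have f_0: "f 0 = 0"
    by (simp add: f_def h_def H0)
  have f1: "f w = ?c w * ?X * q w 0" for w
    using f_diff[of w 0] by (simp add: f_0)
  have f2: "f w = ?c w * ?X * q 0 w" for w
    using f_diff[of 0 w] by (simp add: f_0)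
  have f_pow: "f w ^ e = ?X ^ e * r w" if "w \<in> W" for w
    using arg_cong[OF h_eq[OF that], of fps_to_fls]
    by (simp add: f_def r_def fls_times_fps_to_fls fps_to_fls_power)
  have q_nz: "q v w \<noteq> 0" for v w
  proof -
    have "fps_eval2 v w (fps_divdiff H) $ 0 \<noteq> 0"
      using H1_nz by (simp add: fps_eval2_const_term)
    thus ?thesis by (auto simp: q_def)
  qed
  have q00: "q 0 0 ^ e = ?c (R $ 0)"
  proof -
    have "fps_eval2 0 0 (fps_divdiff H) = fps_const (\<rho> $ 0)"
      by (rule fps_ext) (auto simp: fps_eval2_divdiff_nth H1[symmetric] power_0_left intro!: sum.neutral)
    thus ?thesis
      by (simp add: q_def R_def fls_const_power fps_nth_power_0)
  qed
  have pow_c: "?c w ^ e = 1" if "w \<in> W" for w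
    using that by (simp add: W_def flip: fls_const_power)
  \<comment> \<open>The two factorisations of \<open>f w\<close> serve different purposes:
    \<open>q w 0\<close> accounts for R(H_i) and \<open>q 0 w\<close> for H_i^e, matching the
    left-hand side of \<open>prod_divdiff_eq\<close>.\<close>
  have r_q: "r w = q w 0 ^ e" if "w \<in> W" for w
    using f_pow[OF that] by (simp add: f1 power_mult_distrib pow_c[OF that])
  have f_q: "f w ^ e = ?X ^ e * q 0 w ^ e" if "w \<in> W" for w
    by (simp add: f2 power_mult_distrib pow_c[OF that])
  have f_nz: "f w \<noteq> 0" and r_nz: "r w \<noteq> 0" if "w \<in> W" for w
    using f1[of w] r_q[OF that] W0[OF that] q_nz by auto
  \<comment> \<open>By the chain rule the derivative of \<open>h w\<close> is w times the diagonal
    value \<open>q w w\<close>, which makes this factor the diagonal counterpart of the differences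
    \<open>f w - f v\<close>.\<close>
  have last: "of_nat e / f w - r' w / r w = of_nat e / (?c w * ?X * q w w)" if w: "w \<in> W" for w
  proof -
    have "fps_deriv (h w) = fps_const w * fps_eval2 w w (fps_divdiff H)"
      by (simp add: h_def fps_compose_deriv fps_eval2_divdiff_diag mult.commute)
    from arg_cong[OF fps_power_equation_log_deriv[OF h0 h_eq[OF w] e], of fps_to_fls, unfolded this]
    have "(of_nat e * r w - f w * r' w) * (?c w * ?X * q w w) = of_nat e * f w * r w"
      by (simp add: fls_times_fps_to_fls f_def r_def r'_def q_def mult_ac)
    moreover have "?c w * ?X * q w w \<noteq> 0"
      using W0[OF w] q_nz by simp
    ultimately show ?thesis
      using f_nz[OF w] r_nz[OF w] by (simp add: divide_simps) (simp add: algebra_simps)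
  qed
  \<comment> \<open>The differences contribute X^(e-1) and the product of all w - v, which is e
    w^(e-1). The last factor supplies the missing w X \<open>q w w\<close>; then w^e = 1 and both
    factors e cancel.\<close>
  have diag: "(\<Prod>v\<in>W - {w}. 1 / (f w - f v)) * (of_nat e / f w - r' w / r w)
      = 1 / (?X ^ e * (\<Prod>v\<in>W. q w v))" if w: "w \<in> W" for w
  proof -
    have cardw: "card (W - {w}) = e - 1"
      using w fin by (simp add: card_W)
    have "(\<Prod>v\<in>W - {w}. f w - f v) = ?c (\<Prod>v\<in>W - {w}. w - v) * ?X ^ (e - 1) * (\<Prod>v\<in>W - {w}. q w v)"
      by (simp add: f_diff prod.distrib cardw flip: fls_const_prod)
    also have "(\<Prod>v\<in>W - {w}. w - v) = of_nat e * w ^ (e - 1)"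
      using w unfolding W_def by (rule prod_diff_roots_of_unity[OF e card_W[unfolded W_def]])
    also have "?c (of_nat e * w ^ (e - 1)) = of_nat e * ?c w ^ (e - 1)"
      by (simp add: fls_of_nat flip: fls_const_power)
    finally have "(\<Prod>v\<in>W - {w}. f w - f v) * (?c w * ?X * q w w)
        = of_nat e * (?c w * ?c w ^ (e - 1)) * (?X * ?X ^ (e - 1)) * (q w w * (\<Prod>v\<in>W - {w}. q w v))"
      by (simp only: mult_ac)
    also have "\<dots> = of_nat e * (?X ^ e * (\<Prod>v\<in>W. q w v))"
    proof -
      have "x * x ^ (e - 1) = x ^ e" for x :: "'b fls"
        using e by (cases e) simp_all
      thus ?thesis
        using pow_c[OF w] prod.remove[OF fin w, of "q w"] by simp
    qed
    finally have *: "(\<Prod>v\<in>W - {w}. f w - f v) * (?c w * ?X * q w w)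
        = of_nat e * (?X ^ e * (\<Prod>v\<in>W. q w v))" .
    have "(\<Prod>v\<in>W - {w}. 1 / (f w - f v)) * (of_nat e / f w - r' w / r w)
        = of_nat e / ((\<Prod>v\<in>W - {w}. f w - f v) * (?c w * ?X * q w w))"
      by (simp add: last[OF w] prod_dividef)
    also have "\<dots> = 1 / (?X ^ e * (\<Prod>v\<in>W. q w v))"
      unfolding * using e by simp
    finally show ?thesis .
  qed

  have pairs: "(\<Prod>(v, w) \<in> {(v, w). v \<in> W \<and> w \<in> W \<and> v \<noteq> w}. 1 / (f w - f v))
      = (\<Prod>w\<in>W. \<Prod>v\<in>W - {w}. 1 / (f w - f v))"
  proof -
    have "(\<Prod>(v, w) \<in> {(v, w). v \<in> W \<and> w \<in> W \<and> v \<noteq> w}. 1 / (f w - f v))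
        = (\<Prod>(w, v) \<in> (SIGMA w:W. W - {w}). 1 / (f w - f v))"
      by (rule prod.reindex_bij_witness[of _ prod.swap prod.swap]) auto
    also have "\<dots> = (\<Prod>w\<in>W. \<Prod>v\<in>W - {w}. 1 / (f w - f v))"
      using fin by (subst prod.Sigma) auto
    finally show ?thesis .
  qed

  have "(\<Prod>k\<in>W. \<Prod>i\<in>W. q k 0 * q 0 i)
      = fps_to_fls (G e R oo fps_X ^ e) * (\<Prod>k\<in>W. \<Prod>i\<in>W. q k i * q 0 0)"
    using arg_cong[OF prod_divdiff_eq[OF \<phi>\<rho> \<phi>0 H\<phi> H0 H1_nz e card_W[unfolded W_def]], of fps_to_fls]
    by (simp add: q_def W_def R_def fps_to_fls_prod fls_times_fps_to_fls)
  also have "(\<Prod>k\<in>W. \<Prod>i\<in>W. q k 0 * q 0 i) = (\<Prod>k\<in>W. q k 0 ^ e) * (\<Prod>i\<in>W. q 0 i ^ e)"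
    by (simp add: prod.distrib card_W prod_power_distrib)
  \<comment> \<open>The e^2 copies of \<open>q 0 0\<close> amount to e copies of R(0), by
    \<open>q00\<close>.\<close>
  also have "(\<Prod>k\<in>W. \<Prod>i\<in>W. q k i * q 0 0) = (\<Prod>k\<in>W. \<Prod>i\<in>W. q k i) * ?c (R $ 0) ^ e"
    by (simp add: prod.distrib card_W q00)
  finally have main: "(\<Prod>w\<in>W. r w) * (\<Prod>w\<in>W. q 0 w ^ e)
      = fps_to_fls (G e R oo fps_X ^ e) * ((\<Prod>k\<in>W. \<Prod>i\<in>W. q k i) * ?c (R $ 0) ^ e)"
    by (simp add: r_q)

  have "(\<Prod>w\<in>W. r w / ?c (R $ 0)) = (\<Prod>w\<in>W. r w) / ?c (R $ 0) ^ e"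
    by (simp add: prod_dividef card_W)
  moreover have "(\<Prod>w\<in>W. f w ^ e) = ?X ^ (e * e) * (\<Prod>w\<in>W. q 0 w ^ e)"
    by (simp add: f_q prod.distrib card_W flip: power_mult)
  moreover have "(\<Prod>(v, w) \<in> {(v, w). v \<in> W \<and> w \<in> W \<and> v \<noteq> w}. 1 / (f w - f v))
      * (\<Prod>w\<in>W. of_nat e / f w - r' w / r w)
      = 1 / (?X ^ (e * e) * (\<Prod>k\<in>W. \<Prod>i\<in>W. q k i))"
  proof -
    have "(\<Prod>(v, w) \<in> {(v, w). v \<in> W \<and> w \<in> W \<and> v \<noteq> w}. 1 / (f w - f v))
        * (\<Prod>w\<in>W. of_nat e / f w - r' w / r w) = (\<Prod>w\<in>W. 1 / (?X ^ e * (\<Prod>v\<in>W. q w v)))"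
      unfolding pairs prod.distrib[symmetric] by (intro prod.cong refl diag)
    thus ?thesis
      by (simp add: prod_dividef prod.distrib card_W flip: power_mult)
  qed
  ultimately have "(\<Prod>w\<in>W. r w / ?c (R $ 0)) * (\<Prod>w\<in>W. f w ^ e)
      * (\<Prod>(v, w) \<in> {(v, w). v \<in> W \<and> w \<in> W \<and> v \<noteq> w}. 1 / (f w - f v))
      * (\<Prod>w\<in>W. of_nat e / f w - r' w / r w)
    = ((\<Prod>w\<in>W. r w) * (\<Prod>w\<in>W. q 0 w ^ e))
      / ((\<Prod>k\<in>W. \<Prod>i\<in>W. q k i) * ?c (R $ 0) ^ e)"
    by (simp add: mult.assoc)
  also have "\<dots> = fps_to_fls (G e R oo fps_X ^ e)"
    unfolding main using q_nz \<rho>0 fin by (simp add: R_def fps_nth_power_0)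
  finally show ?thesis
    unfolding f_def r_def r'_def by (rule sym)
qed

section \<open>Transfer to the algebraic closure\<close>

lemma fps_to_ac_nth [simp]: "fps_to_ac F $ n = to_ac (F $ n)"
  by (simp add: fps_to_ac_def)

lemma fps_to_ac_mult: "fps_to_ac (F * E) = fps_to_ac F * fps_to_ac E"
  by (rule fps_ext) (simp add: fps_mult_nth to_ac_sum)

lemma fps_to_ac_power: "fps_to_ac (F ^ n) = fps_to_ac F ^ n"
proof (induction n)
  case 0
  show ?case by (rule fps_ext) simp
qed (simp add: fps_to_ac_mult)

lemma fps_to_ac_compose: "fps_to_ac (F oo E) = fps_to_ac F oo fps_to_ac E"
  by (rule fps_ext) (simp add: fps_compose_nth to_ac_sum flip: fps_to_ac_power)

lemma fps_to_ac_deriv: "fps_to_ac (fps_deriv F) = fps_deriv (fps_to_ac F)"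
  by (rule fps_ext) simp

lemma fps_to_ac_X: "fps_to_ac fps_X = fps_X"
  by (rule fps_ext) (simp add: fps_X_def)

text \<open>\<open>to_ac\<close> is a field homomorphism, and the coefficients of the exponent and
  of the exponential series are built by finitely many field operations.\<close>

lemma fps_to_ac_G:
  fixes R :: "'a::field_char_0 fps"
  shows "fps_to_ac (G e R) = G e (fps_to_ac R)"
proof -
  have "fps_to_ac (fps_exp (1 :: 'a)) = fps_exp 1"
    by (rule fps_ext) (simp del: of_nat_fact)
  moreover have "fps_to_ac (G_exponent e R) = G_exponent e (fps_to_ac R)"
    by (rule fps_ext) (simp add: G_exponent_nth to_ac_sum flip: fps_to_ac_power)
  ultimately show ?thesis
    by (simp add: G_def fps_to_ac_compose)
qed

text \<open>An e-th root of the constant term extends to an e-th root \<rho> of the series. Then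
  \<phi> = X / \<rho> has nonzero linear coefficient and hence a two-sided compositional
  inverse.\<close>

lemma fps_root_reversion_exists:
  fixes R :: "'b::{alg_closed_field, field_char_0} fps"
  assumes e: "e > 0" and R0: "R $ 0 \<noteq> 0"
  obtains \<phi> \<rho> H where "\<rho> ^ e = R" "\<phi> * \<rho> = fps_X" "\<phi> $ 0 = 0" "\<rho> $ 0 \<noteq> 0"
    "H oo \<phi> = fps_X" "\<phi> oo H = fps_X" "H $ 0 = 0"
proof -
  obtain d where d: "e = Suc d" using e by (cases e) auto
  obtain c where c: "c ^ e = R $ 0" using nth_root_exists[OF e] by metis
  hence c0: "c \<noteq> 0" using R0 e by (auto simp: power_0_left)
  \<comment> \<open>The constant function suffices as choice of roots, because only the e-th root of
    \<open>R $ 0\<close> is ever requested.\<close>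
  define \<rho> where "\<rho> = fps_radical (\<lambda>_ _. c) e R"
  define \<phi> where "\<phi> = fps_X * inverse \<rho>"
  have \<rho>: "\<rho> ^ e = R"
    using power_radical[OF R0, of "\<lambda>_ _. c" d] c by (simp add: \<rho>_def d)
  have \<rho>0: "\<rho> $ 0 \<noteq> 0"
    using c0 e by (simp add: \<rho>_def)
  have \<phi>: "\<phi> $ 0 = 0" "\<phi> $ 1 \<noteq> 0"
    using \<rho>0 by (simp_all add: \<phi>_def)
  show ?thesis
  proof (rule that[OF \<rho>])
    show "\<phi> * \<rho> = fps_X"
      by (simp add: \<phi>_def mult.assoc inverse_mult_eq_1[OF \<rho>0])
    show "fps_inv \<phi> oo \<phi> = fps_X" "\<phi> oo fps_inv \<phi> = fps_X"
      by (rule fps_inv[OF \<phi>] fps_inv_right[OF \<phi>])+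
    show "fps_inv \<phi> $ 0 = 0"
      by (simp add: fps_inv_def)
  qed (use \<phi> \<rho>0 in auto)
qed

text \<open>The cardinality guarantees that enumerations \<open>H\<close> exist, so the identity is
  not vacuous. It lives in Laurent series in s because the reciprocals of solutions and of their
  differences have poles.\<close>

theorem theorem1p1:
  fixes R :: "'a::field_char_0 fps" and e :: nat
  assumes "e > 0" and "R $ 0 \<noteq> 0"
  shows "card (puiseux_solutions e R) = e \<and>
    (\<forall>H. bij_betw H {1..e} (puiseux_solutions e R) \<longrightarrow>
      fps_to_fls (in_q e (G e R)) =
        (\<Prod>i=1..e. subst_fls R (H i) / fls_const (to_ac (R $ 0)))
        * (\<Prod>i=1..e. fps_to_fls (H i) ^ e)
        * (\<Prod>(i1, i2) \<in> {(i1, i2). i1 \<in> {1..e} \<and> i2 \<in> {1..e} \<and> i1 \<noteq> i2}.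
             1 / (fps_to_fls (H i2) - fps_to_fls (H i1)))
        * (\<Prod>i=1..e. of_nat e / fps_to_fls (H i)
             - subst_fls (fps_deriv R) (H i) / subst_fls R (H i)))"
proof -
  define S where "S = fps_to_ac R"
  have "S $ 0 \<noteq> 0"
    using assms(2) by (simp add: S_def)
  then obtain \<phi> \<rho> K where \<rho>: "\<rho> ^ e = S" and \<phi>\<rho>: "\<phi> * \<rho> = fps_X" and \<phi>0: "\<phi> $ 0 = 0"
    and \<rho>0: "\<rho> $ 0 \<noteq> 0" and K\<phi>: "K oo \<phi> = fps_X" and \<phi>K: "\<phi> oo K = fps_X" and K0: "K $ 0 = 0"
    using fps_root_reversion_exists[OF assms(1)] by blast
  define W :: "'a alg_closure set" where "W = {w. w ^ e = 1}"
  define h where "h = (\<lambda>w. K oo fps_const w * fps_X)"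
  note card_W = card_roots_of_unity[OF assms(1), where ?'b = "'a alg_closure"]
  have in_q_X: "in_q e fps_X = fps_X ^ e"
    using assms(1) by (simp add: in_q_def fps_to_ac_X power_0_left)
  have sols: "puiseux_solutions e R = h ` W"
    using fps_power_equation_roots[OF \<phi>\<rho> \<phi>0 \<rho>0 K\<phi> \<phi>K K0 assms(1) card_W]
    by (simp add: puiseux_solutions_def in_q_X \<rho> S_def W_def h_def)
  \<comment> \<open>The parameter w is recovered from the solution, since \<phi>(K(w X)) = w
    X.\<close>
  have inj_h: "inj_on h W"
  proof (rule inj_onI)
    fix v w assume "h v = h w"
    hence "\<phi> oo h v = \<phi> oo h w" by simp
    hence "fps_const v * fps_X = fps_const w * (fps_X :: 'a alg_closure fps)"
      by (simp add: h_def fps_compose_assoc K0 \<phi>K)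
    thus "v = w" by simp
  qed
  have bij_h: "bij_betw h W (puiseux_solutions e R)"
    using inj_h by (simp add: sols bij_betw_def)
  have "card (puiseux_solutions e R) = e"
    using bij_betw_same_card[OF bij_h] card_W by (simp add: W_def)
  moreover have "fps_to_fls (in_q e (G e R)) =
        (\<Prod>i=1..e. subst_fls R (H i) / fls_const (to_ac (R $ 0)))
        * (\<Prod>i=1..e. fps_to_fls (H i) ^ e)
        * (\<Prod>(i1, i2) \<in> {(i1, i2). i1 \<in> {1..e} \<and> i2 \<in> {1..e} \<and> i1 \<noteq> i2}.
             1 / (fps_to_fls (H i2) - fps_to_fls (H i1)))
        * (\<Prod>i=1..e. of_nat e / fps_to_fls (H i)
             - subst_fls (fps_deriv R) (H i) / subst_fls R (H i))"
    if H: "bij_betw H {1..e} (puiseux_solutions e R)" for H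
  proof -
    \<comment> \<open>This relabels an arbitrary enumeration by roots of unity, so that products
      over indices become products over \<open>W\<close>.\<close>
    define \<sigma> where "\<sigma> = (\<lambda>i. inv_into W h (H i))"
    have \<sigma>: "bij_betw \<sigma> {1..e} W"
      using bij_betw_trans[OF H bij_betw_inv_into[OF bij_h]] by (simp add: \<sigma>_def o_def)
    have H_eq: "H i = h (\<sigma> i)" if "i \<in> {1..e}" for i
      using that H bij_h unfolding \<sigma>_def
      by (metis bij_betw_apply bij_betw_inv_into_right)
    have single: "(\<Prod>i=1..e. g (H i)) = (\<Prod>w\<in>W. g (h w))"
      for g :: "'a alg_closure fps \<Rightarrow> 'a alg_closure fls"
      using prod.reindex_bij_betw[OF \<sigma>, of "\<lambda>w. g (h w)"] by (simp add: H_eq)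
    have pairs_bij: "bij_betw (map_prod \<sigma> \<sigma>) {(i, j). i \<in> {1..e} \<and> j \<in> {1..e} \<and> i \<noteq> j}
        {(v, w). v \<in> W \<and> w \<in> W \<and> v \<noteq> w}"
    proof (rule bij_betw_subset[OF bij_betw_map_prod[OF \<sigma> \<sigma>]])
      show "map_prod \<sigma> \<sigma> ` {(i, j). i \<in> {1..e} \<and> j \<in> {1..e} \<and> i \<noteq> j}
          = {(v, w). v \<in> W \<and> w \<in> W \<and> v \<noteq> w}"
      proof (intro equalityI subsetI)
        fix x assume "x \<in> map_prod \<sigma> \<sigma> ` {(i, j). i \<in> {1..e} \<and> j \<in> {1..e} \<and> i \<noteq> j}"
        then obtain i j where ij: "x = (\<sigma> i, \<sigma> j)" "i \<in> {1..e}" "j \<in> {1..e}" "i \<noteq> j"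
          by auto
        hence "\<sigma> i \<in> W" "\<sigma> j \<in> W" "\<sigma> i \<noteq> \<sigma> j"
          using bij_betwE[OF \<sigma>] inj_on_eq_iff[OF bij_betw_imp_inj_on[OF \<sigma>]] by auto
        thus "x \<in> {(v, w). v \<in> W \<and> w \<in> W \<and> v \<noteq> w}"
          using ij by simp
      next
        fix x assume "x \<in> {(v, w). v \<in> W \<and> w \<in> W \<and> v \<noteq> w}"
        then obtain v w where x: "x = (v, w)" "v \<in> W" "w \<in> W" "v \<noteq> w" by auto
        then obtain i j where "i \<in> {1..e}" "j \<in> {1..e}" "v = \<sigma> i" "w = \<sigma> j"
          using \<sigma> unfolding bij_betw_def by blast
        thus "x \<in> map_prod \<sigma> \<sigma> ` {(i, j). i \<in> {1..e} \<and> j \<in> {1..e} \<and> i \<noteq> j}"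
          using x by (intro image_eqI[of _ _ "(i, j)"]) auto
      qed
    qed auto
    have pairs: "(\<Prod>(i1, i2) \<in> {(i1, i2). i1 \<in> {1..e} \<and> i2 \<in> {1..e} \<and> i1 \<noteq> i2}.
          1 / (fps_to_fls (H i2) - fps_to_fls (H i1)))
        = (\<Prod>(v, w) \<in> {(v, w). v \<in> W \<and> w \<in> W \<and> v \<noteq> w}.
          1 / (fps_to_fls (h w) - fps_to_fls (h v)))"
      unfolding prod.reindex_bij_betw[OF pairs_bij, symmetric]
      by (intro prod.cong refl) (auto simp: H_eq)
    have "fps_to_fls (in_q e (G e R)) = fps_to_fls (G e (\<rho> ^ e) oo fps_X ^ e)"
      by (simp add: in_q_def fps_to_ac_G \<rho> S_def)
    also note G_eq_prod[OF \<phi>\<rho> \<phi>0 \<rho>0 K\<phi> \<phi>K K0 assms(1) card_W]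
    finally show ?thesis
      unfolding pairs single[of "\<lambda>F. subst_fls R F / fls_const (to_ac (R $ 0))"]
        single[of "\<lambda>F. fps_to_fls F ^ e"]
        single[of "\<lambda>F. of_nat e / fps_to_fls F - subst_fls (fps_deriv R) F / subst_fls R F"]
      by (simp add: subst_fls_def fps_to_ac_deriv \<rho> S_def W_def h_def)
  qed
  ultimately show ?thesis by blast
qed

end
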